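(* $\mathcal E_{3,11}\mathcal E_{7,11}+\mathcal E_{1,11}\mathcal E_{7,11}-\mathcal E_{3,11}\mathcal E_{5,11}-\mathcal E_{5,11}\mathcal E_{7,11}=0$ and $\mathcal E_{1,11}\mathcal E_{3,11}-\mathcal E_{1,11}\mathcal E_{5,11}+\mathcal E_{5,11}\mathcal E_{7,11}=0$.
   Context: $q=e^{2\pi i\tau}$. For an odd Dirichlet character $\chi$ mod $11$, $E_{1,\chi}(\tau)=1+\frac{2}{L(0,\chi)}\sum_{n\ge1}\chi(n)\frac{q^n}{1-q^n}$ ($L(0,\chi)$ the value at $0$ of the continued $L$-function). For $a$ coprime to $11$, $\mathcal E_{a,11}=\frac{2}{10}\sum_{\chi\text{ odd mod }11}\chi(a)E_{1,\chi}$ (equivalently $(\gamma_{21}\tau+\gamma_{22})^{-1}\mathcal E_{1,11}(\gamma\tau)$ for $\gamma\in SL(2,\mathbb Z)$, $\gamma_{21}\equiv0$, $\gamma_{22}\equiv a\pmod{11}$). *)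

theory Defs
  imports "HOL-Complex_Analysis.Complex_Analysis" "HOL-Number_Theory.Number_Theory"
begin

text \<open>Dirichlet characters are extended by zero to all integers.\<close>

definition dirichlet_character :: "nat \<Rightarrow> (int \<Rightarrow> complex) \<Rightarrow> bool" where
  "dirichlet_character N chi \<longleftrightarrow>
     (\<forall>a b. chi (a * b) = chi a * chi b) \<and>
     (\<forall>a b. [a = b] (mod int N) \<longrightarrow> chi a = chi b) \<and>
     (\<forall>a. chi a \<noteq> 0 \<longleftrightarrow> coprime a (int N))"

definition odd_dirichlet_characters :: "nat \<Rightarrow> (int \<Rightarrow> complex) set" where
  "odd_dirichlet_characters N = {chi. dirichlet_character N chi \<and> chi (-1) = -1}"

text \<open>
  The value at \<open>s\<close> of the analytic continuation of the Dirichlet series of \<open>chi\<close>, as a holomorphic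
  function, to some open right half-plane containing both \<open>s\<close> and the half-plane \<open>Re z > 1\<close>.
  By the identity theorem this value does not depend on the half-plane or on the continuation.
  It is the usual \<open>L(s, chi)\<close> for every \<open>s\<close> when \<open>chi\<close> is non-principal (in particular when it is
  odd); for a principal \<open>chi\<close>, whose \<open>L\<close>-function has a pole at \<open>1\<close>, it is meaningful only for
  \<open>Re s > 1\<close>.
\<close>

definition dirichlet_L :: "(int \<Rightarrow> complex) \<Rightarrow> complex \<Rightarrow> complex" where
  "dirichlet_L chi s = (THE w. \<exists>c f. c \<le> 1 \<and> c < Re s \<and> f holomorphic_on {z. c < Re z} \<and>
     (\<forall>z. 1 < Re z \<longrightarrow> (\<lambda>n. chi (int (Suc n)) * of_nat (Suc n) powr (- z)) sums f z) \<and>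
     w = f s)"

definition q_param :: "complex \<Rightarrow> complex" where
  "q_param \<tau> = exp (2 * of_real pi * \<i> * \<tau>)"

definition eisenstein_E1 :: "(int \<Rightarrow> complex) \<Rightarrow> complex \<Rightarrow> complex" where
  "eisenstein_E1 chi \<tau> = 1 + 2 / dirichlet_L chi 0 *
     (\<Sum>n. chi (int (Suc n)) * (q_param \<tau> ^ Suc n / (1 - q_param \<tau> ^ Suc n)))"

definition cal_E11 :: "int \<Rightarrow> complex \<Rightarrow> complex" where
  "cal_E11 a \<tau> = 2 / 10 * (\<Sum>chi\<in>odd_dirichlet_characters 11. chi a * eisenstein_E1 chi \<tau>)"

end

theory Submission
  imports Defs
begin

text \<open>
  Put \<open>p = q\<^sup>1\<^sup>1\<close> and \<open>J(x) = \<Sum>\<^bsub>n \<noteq> 0\<^esub> x\<^sup>n / (1 - p\<^sup>n)\<close> for \<open>|p| < |x| < 1\<close>.  Multiplying out,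
  the partial fraction identity for \<open>1 / ((1 - p\<^sup>a) (1 - p\<^sup>b))\<close> gives
  \<open>J(x) J(y) - J(x y) (J(x) + J(y)) = J(x y) + T(x y) + T(x) + T(y)\<close> with
  \<open>T(x) = \<Sum>\<^bsub>n \<noteq> 0\<^esub> p\<^sup>n x\<^sup>n / (1 - p\<^sup>n)\<^sup>2\<close>, the addition theorem of the Weierstrass zeta function.
  Splitting the Lambert series of \<open>E\<^bsub>1,\<chi>\<^esub>\<close> by residue classes and using
  \<open>L(0, \<chi>) = \<Sum>\<^bsub>1 \<le> m \<le> 5\<^esub> \<chi>(m) (1 - 2 m / 11) \<noteq> 0\<close>, orthogonality of characters expresses each
  \<open>J(q\<^sup>r) + 1/2 - r/11\<close> as a rational linear combination of the \<open>\<E>\<^bsub>a,11\<^esub>\<close>.  There are ten addition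
  formulas at \<open>(q\<^sup>r, q\<^sup>s)\<close> and five unknowns \<open>T(q\<^sup>r)\<close>; eliminating these leaves five quadratic
  relations, two of which are the claim.
\<close>

section \<open>Bilateral Lambert series\<close>

definition bilateral_lambert :: "complex \<Rightarrow> complex \<Rightarrow> complex" where
  "bilateral_lambert p x = (\<Sum>\<^sub>\<infinity>n\<in>-{0::int}. x powi n / (1 - p powi n))"

text \<open>Termwise, \<open>x * d/dx\<close> of this series is \<open>p * d/dp\<close> of
  \<open>bilateral_lambert\<close>. The factor \<open>p^n / (1 - p^n)^2\<close> is even in
  \<open>n\<close>.\<close>

definition bilateral_lambert2 :: "complex \<Rightarrow> complex \<Rightarrow> complex" where
  "bilateral_lambert2 p x = (\<Sum>\<^sub>\<infinity>n\<in>-{0::int}. x powi n * p powi n / (1 - p powi n)\<^sup>2)"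

section \<open>Convergence of the two series in the annulus \<open>|p| < |x| < 1\<close>\<close>

lemma summable_on_power_nat_abs:
  fixes r :: real
  assumes "0 \<le> r" "r < 1"
  shows "(\<lambda>n::int. r ^ nat \<bar>n\<bar>) summable_on A"
proof (rule summable_on_subset)
  have g: "(\<lambda>n. r ^ n) summable_on (UNIV :: nat set)"
    using assms by (intro norm_summable_imp_summable_on) (simp add: summable_geometric)
  have "(\<lambda>n::int. r ^ nat \<bar>n\<bar>) summable_on (int ` UNIV)"
    by (subst summable_on_reindex) (auto simp: o_def g)
  moreover have "(\<lambda>n::int. r ^ nat \<bar>n\<bar>) summable_on ((\<lambda>n. - int n) ` {1..})"
    by (subst summable_on_reindex)
       (auto simp: o_def inj_on_def intro!: summable_on_subset[OF g])
  ultimately have "(\<lambda>n::int. r ^ nat \<bar>n\<bar>) summable_on (int ` UNIV \<union> (\<lambda>n. - int n) ` {1..})"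
    by (rule summable_on_Un_disjoint) auto
  moreover have "int ` UNIV \<union> (\<lambda>n. - int n) ` {1..} = UNIV"
  proof -
    have "z \<in> int ` UNIV \<union> (\<lambda>n. - int n) ` {1..}" for z
      by (cases z rule: int_cases) force+
    thus ?thesis by blast
  qed
  ultimately show "(\<lambda>n::int. r ^ nat \<bar>n\<bar>) summable_on UNIV" by simp
qed auto

text \<open>This keeps the denominators away from 0 uniformly in \<open>n\<close>. For negative
  \<open>n\<close> one has \<open>|p^n| >= 1 / |p|\<close>, and
  \<open>1 / |p| - 1 >= 1 - |p|\<close> because \<open>(1 - |p|)^2 >= 0\<close>.\<close>

lemma norm_one_minus_powi_ge:
  fixes p :: complex
  assumes "0 < norm p" "norm p < 1" "n \<noteq> (0::int)"
  shows "1 - norm p \<le> norm (1 - p powi n)"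
proof (cases "n > 0")
  case True
  then obtain m where m: "n = int m" "m > 0"
    by (metis zero_less_imp_eq_int)
  have "norm p ^ m \<le> norm p ^ 1"
    using assms m by (intro power_decreasing) auto
  moreover have "norm (1::complex) - norm (p ^ m) \<le> norm (1 - p ^ m)"
    by (rule norm_triangle_ineq2)
  ultimately show ?thesis
    by (simp add: m norm_power)
next
  case False
  then obtain m where m: "n = - int m" "m > 0"
    using assms(3) by (metis add.inverse_inverse int_cases4 linorder_neqE_linordered_idom
      of_nat_0_less_iff neg_0_less_iff_less zero_less_imp_eq_int)
  have "1 \<le> inverse (norm p) ^ m"
    using assms by (intro one_le_power) (simp add: one_le_inverse)
  moreover have "inverse (norm p) ^ 1 \<le> inverse (norm p) ^ m"
    using assms m by (intro power_increasing) (auto simp: one_le_inverse)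
  moreover have "norm (p powi n) - norm (1::complex) \<le> norm (p powi n - 1)"
    by (rule norm_triangle_ineq2)
  moreover have "norm (p powi n) = inverse (norm p) ^ m"
    by (simp add: m power_int_minus norm_power norm_inverse power_inverse)
  moreover have "1 - norm p \<le> inverse (norm p) - 1"
  proof -
    have "0 \<le> (1 - norm p)\<^sup>2" by simp
    hence "2 * norm p \<le> 1 + norm p * norm p"
      by (simp add: power2_eq_square algebra_simps)
    thus ?thesis using assms by (simp add: field_simps)
  qed
  ultimately show ?thesis by (simp add: norm_minus_commute)
qed

lemma one_minus_powi_nonzero:
  fixes p :: complex
  assumes "0 < norm p" "norm p < 1" "n \<noteq> (0::int)"
  shows "1 - p powi n \<noteq> 0"
  using norm_one_minus_powi_ge[OF assms] assms by auto

text \<open>For \<open>n = -m < 0\<close> the term equals \<open>- (p / x)^m / (1 - p^m)\<close>.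
  The two halves of the series thus decay like powers of \<open>x\<close> and of
  \<open>p / x\<close>, both of norm below 1 in the annulus.\<close>

lemma norm_bilateral_lambert_term_le:
  fixes p x :: complex
  assumes "0 < norm p" "norm p < norm x" "norm x < 1" "n \<noteq> (0::int)"
  shows "norm (x powi n / (1 - p powi n)) \<le>
           max (norm x) (norm p / norm x) ^ nat \<bar>n\<bar> / (1 - norm p)"
proof (cases "n > 0")
  case True
  then obtain m where m: "n = int m" "m > 0"
    by (metis zero_less_imp_eq_int)
  have "norm x ^ m \<le> max (norm x) (norm p / norm x) ^ m"
    by (intro power_mono) auto
  moreover have "norm (1 - p powi n) \<ge> 1 - norm p"
    by (rule norm_one_minus_powi_ge) (use assms in auto)
  ultimately have "norm x ^ m / norm (1 - p powi n) \<le> max (norm x) (norm p / norm x) ^ m / (1 - norm p)"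
    using assms by (intro frac_le) (auto simp: le_max_iff_disj)
  thus ?thesis by (simp add: m norm_divide norm_power)
next
  case False
  then obtain m where m: "n = - int m" "m > 0"
    using assms(4) by (metis add.inverse_inverse int_cases4 linorder_neqE_linordered_idom
      of_nat_0_less_iff neg_0_less_iff_less zero_less_imp_eq_int)
  have nz: "p \<noteq> 0" "x \<noteq> 0" using assms by auto
  have "1 - p powi int m \<noteq> 0"
    by (rule one_minus_powi_nonzero) (use assms m in auto)
  hence eq: "x powi n / (1 - p powi n) = - ((p / x) ^ m / (1 - p powi int m))"
    using nz one_minus_powi_nonzero[of p n] assms
    by (simp add: m power_int_minus field_simps)
  have "(norm p / norm x) ^ m \<le> max (norm x) (norm p / norm x) ^ m"
    using assms by (intro power_mono) auto
  moreover have "norm (1 - p powi int m) \<ge> 1 - norm p"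
    by (rule norm_one_minus_powi_ge) (use assms m in auto)
  ultimately have "(norm p / norm x) ^ m / norm (1 - p powi int m) \<le> max (norm x) (norm p / norm x) ^ m / (1 - norm p)"
    using assms by (intro frac_le) (auto simp: le_max_iff_disj)
  thus ?thesis unfolding eq by (simp add: m norm_divide norm_power)
qed

lemma norm_annulus_reflect:
  fixes p x :: complex
  assumes "0 < norm p" "norm p < norm x" "norm x < 1"
  shows "norm p < norm (p / x)" "norm (p / x) < 1"
proof -
  have x: "0 < norm x" using assms by linarith
  have "norm p * norm x < norm p * 1"
    using assms by (intro mult_strict_left_mono) auto
  thus "norm p < norm (p / x)" "norm (p / x) < 1"
    using x assms by (auto simp: norm_divide divide_simps)
qed

lemma abs_summable_bilateral_lambert:
  fixes p x :: complex
  assumes "0 < norm p" "norm p < norm x" "norm x < 1"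
  shows "(\<lambda>n. norm (x powi n / (1 - p powi n))) summable_on -{0::int}"
proof (rule Infinite_Sum.abs_summable_on_comparison_test')
  let ?r = "max (norm x) (norm p / norm x)"
  have "0 \<le> ?r" "?r < 1"
    using assms norm_annulus_reflect[OF assms] by (auto simp: norm_divide le_max_iff_disj)
  from summable_on_power_nat_abs[OF this, of "-{0}"]
  show "(\<lambda>n. ?r ^ nat \<bar>n\<bar> / (1 - norm p)) summable_on -{0::int}"
    using summable_on_cmult_left[of _ _ "1 / (1 - norm p)"] by fastforce
qed (use norm_bilateral_lambert_term_le assms in auto)

lemma has_sum_bilateral_lambert:
  fixes p x :: complex
  assumes "0 < norm p" "norm p < norm x" "norm x < 1"
  shows "((\<lambda>n. x powi n / (1 - p powi n)) has_sum bilateral_lambert p x) (-{0::int})"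
  unfolding bilateral_lambert_def
  using abs_summable_summable[OF abs_summable_bilateral_lambert[OF assms]] by (rule has_sum_infsum)

lemma powi_div_one_minus_powi:
  fixes p :: complex
  assumes "0 < norm p" "norm p < 1" "n \<noteq> (0::int)"
  shows "p powi n / (1 - p powi n) = 1 / (1 - p powi n) - 1"
  using one_minus_powi_nonzero[OF assms] by (simp add: field_simps)

lemma has_sum_bilateral_lambert2:
  fixes p x :: complex
  assumes "0 < norm p" "norm p < norm x" "norm x < 1"
  shows "((\<lambda>n. x powi n * p powi n / (1 - p powi n)\<^sup>2) has_sum bilateral_lambert2 p x) (-{0::int})"
  unfolding bilateral_lambert2_def
proof (rule has_sum_infsum, rule abs_summable_summable, rule Infinite_Sum.abs_summable_on_comparison_test')
  \<comment> \<open>The summand is that of the first series times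
    \<open>p^n / (1 - p^n) = 1 / (1 - p^n) - 1\<close>, and \<open>?C\<close> bounds this
    factor.\<close>
  let ?C = "1 / (1 - norm p) + 1"
  show "(\<lambda>n. norm (x powi n / (1 - p powi n)) * ?C) summable_on -{0::int}"
    by (intro summable_on_cmult_left abs_summable_bilateral_lambert assms)
  fix n :: int assume n: "n \<in> -{0}"
  have p: "norm p < 1" using assms by linarith
  have "norm (1 / (1 - p powi n)) \<le> 1 / (1 - norm p)"
    using norm_one_minus_powi_ge[of p n] n p assms by (auto simp: norm_divide intro!: frac_le)
  hence "norm (p powi n / (1 - p powi n)) \<le> ?C"
    unfolding powi_div_one_minus_powi[of p n, OF assms(1) p n[unfolded Compl_iff singleton_iff]]
    using norm_triangle_ineq4[of "1 / (1 - p powi n)" 1] by simp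
  hence "norm (x powi n / (1 - p powi n)) * norm (p powi n / (1 - p powi n))
           \<le> norm (x powi n / (1 - p powi n)) * ?C"
    by (intro mult_left_mono) auto
  moreover have "x powi n * p powi n / (1 - p powi n)\<^sup>2 =
      (x powi n / (1 - p powi n)) * (p powi n / (1 - p powi n))"
    by (simp add: power2_eq_square)
  ultimately show "norm (x powi n * p powi n / (1 - p powi n)\<^sup>2) \<le> norm (x powi n / (1 - p powi n)) * ?C"
    by (simp only: norm_mult)
qed

section \<open>Behaviour under the reflection of \<open>x\<close> to \<open>p / x\<close>\<close>

lemma powi_neg_div:
  fixes p x :: complex
  assumes "0 < norm p" "norm p < 1" "x \<noteq> 0" "n \<noteq> (0::int)"
  shows "(p / x) powi (-n) / (1 - p powi (-n)) = - (x powi n / (1 - p powi n))"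
proof -
  have "p \<noteq> 0" using assms by auto
  hence "p powi n \<noteq> 0" "x powi n \<noteq> 0" using assms by auto
  moreover have "1 - p powi n \<noteq> 0" "1 - p powi (-n) \<noteq> 0"
    using one_minus_powi_nonzero[of p] assms by auto
  ultimately show ?thesis
    by (simp add: power_int_minus power_int_divide_distrib field_simps)
qed

lemma bilateral_lambert_reflect:
  fixes p x :: complex
  assumes "0 < norm p" "norm p < norm x" "norm x < 1"
  shows "bilateral_lambert p (p / x) = - bilateral_lambert p x"
proof -
  have nz: "x \<noteq> 0" "norm p < 1" using assms by auto
  from has_sum_bilateral_lambert[OF assms(1) norm_annulus_reflect[OF assms]]
  have "((\<lambda>n. (p / x) powi (-n) / (1 - p powi (-n))) has_sum bilateral_lambert p (p / x)) (-{0})"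
    by (rule iffD2[OF has_sum_reindex_bij_witness[of _ uminus uminus], rotated -1]) auto
  also have "?this \<longleftrightarrow> ((\<lambda>n. - (x powi n / (1 - p powi n))) has_sum bilateral_lambert p (p / x)) (-{0})"
    by (rule has_sum_cong) (use powi_neg_div[of p x] assms nz in auto)
  finally show ?thesis
    using has_sum_uminusI[OF has_sum_bilateral_lambert[OF assms]] has_sum_unique by blast
qed

text \<open>Replacing \<open>n\<close> by \<open>-n\<close> turns the summand at
  \<open>p / x\<close> into \<open>x^n / (1 - p^n)^2\<close>, since \<open>p^n / (1 - p^n)^2\<close>
  is even in \<open>n\<close>. The numerator \<open>1 = p^n + (1 - p^n)\<close> then splits it into
  the two summands at \<open>x\<close>.\<close>

lemma bilateral_lambert2_reflect:
  fixes p x :: complex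
  assumes "0 < norm p" "norm p < norm x" "norm x < 1"
  shows "bilateral_lambert2 p (p / x) = bilateral_lambert2 p x + bilateral_lambert p x"
proof -
  have nz: "x \<noteq> 0" "p \<noteq> 0" "norm p < 1" using assms by auto
  from has_sum_bilateral_lambert2[OF assms(1) norm_annulus_reflect[OF assms]]
  have "((\<lambda>n. (p / x) powi (-n) * p powi (-n) / (1 - p powi (-n))\<^sup>2)
          has_sum bilateral_lambert2 p (p / x)) (-{0})"
    by (rule iffD2[OF has_sum_reindex_bij_witness[of _ uminus uminus], rotated -1]) auto
  also have "?this \<longleftrightarrow> ((\<lambda>n. x powi n * p powi n / (1 - p powi n)\<^sup>2 + x powi n / (1 - p powi n))
          has_sum bilateral_lambert2 p (p / x)) (-{0})"
  proof (rule has_sum_cong)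
    fix n :: int assume "n \<in> -{0}"
    hence "1 - p powi n \<noteq> 0" "1 - p powi (-n) \<noteq> 0"
      using one_minus_powi_nonzero[of p] assms nz by auto
    moreover have "p powi n \<noteq> 0" "x powi n \<noteq> 0" using nz by auto
    ultimately show "(p / x) powi (-n) * p powi (-n) / (1 - p powi (-n))\<^sup>2 =
        x powi n * p powi n / (1 - p powi n)\<^sup>2 + x powi n / (1 - p powi n)"
      by (simp add: power_int_minus power_int_divide_distrib divide_simps power2_eq_square)
         (simp add: algebra_simps)
  qed
  finally show ?thesis
    using has_sum_add[OF has_sum_bilateral_lambert2[OF assms] has_sum_bilateral_lambert[OF assms]]
      has_sum_unique by blast
qed

section \<open>Double series and the addition theorem\<close>

lemma has_sum_product:
  fixes f :: "'a \<Rightarrow> complex" and g :: "'b \<Rightarrow> complex"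
  assumes "(\<lambda>a. norm (f a)) summable_on A" "(\<lambda>b. norm (g b)) summable_on B" "(f has_sum s) A" "(g has_sum t) B"
  shows "((\<lambda>(a, b). f a * g b) has_sum (s * t)) (A \<times> B)"
proof -
  have "(\<lambda>x. norm ((\<lambda>(a, b). f a * g b) x)) summable_on (A \<times> B)"
  proof -
    have "(\<lambda>x. norm ((\<lambda>(a, b). f a * g b) x)) summable_on Sigma A (\<lambda>_. B)"
    proof (rule summable_on_SigmaI)
      show "((\<lambda>y. norm ((\<lambda>(a, b). f a * g b) (x, y))) has_sum (norm (f x) * infsum (\<lambda>y. norm (g y)) B)) B" for x
        using has_sum_cmult_right[OF has_sum_infsum[OF assms(2)], of "norm (f x)"]
        by (simp add: norm_mult)
      show "(\<lambda>x. norm (f x) * infsum (\<lambda>y. norm (g y)) B) summable_on A"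
        by (intro summable_on_cmult_left assms)
    qed auto
    thus ?thesis by simp
  qed
  hence S: "(\<lambda>(a, b). f a * g b) summable_on Sigma A (\<lambda>_. B)"
    by (rule abs_summable_summable)
  show ?thesis
  proof (rule has_sum_SigmaI[OF _ _ S])
    show "((\<lambda>y. (\<lambda>(a, b). f a * g b) (x, y)) has_sum (f x * t)) B" for x
      using has_sum_cmult_right[OF assms(4)] by simp
    show "((\<lambda>x. f x * t) has_sum (s * t)) A"
      by (rule has_sum_cmult_left[OF assms(3)])
  qed
qed

lemma has_sum_diff_subset:
  fixes f :: "'a \<Rightarrow> complex"
  assumes "(f has_sum s) A" "(f has_sum t) B" "B \<subseteq> A"
  shows "(f has_sum (s - t)) (A - B)"
proof -
  have "f summable_on (A - B)"
    using assms(1) summable_on_subset[of f A "A - B"] by (auto simp: summable_on_def)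
  then obtain u where u: "(f has_sum u) (A - B)" by (auto simp: summable_on_def)
  have "(A - B) \<inter> B = {}" "(A - B) \<union> B = A" using assms(3) by auto
  with has_sum_Un_disjoint[OF u assms(2)] have "(f has_sum (u + t)) A" by simp
  with assms(1) have "s = u + t" using has_sum_unique by blast
  with u show ?thesis by simp
qed

text \<open>With \<open>P = p^a\<close> and \<open>Q = p^b\<close> this splits the coefficient of
  \<open>x^a y^b\<close> in \<open>J(x) J(y)\<close> into those of \<open>J(x y) J(x)\<close> and
  \<open>J(x y) J(y)\<close>. Over a common denominator it is
  \<open>Q (1 - P) - P (1 - Q) = Q - P\<close>.\<close>

lemma partial_fractions:
  fixes P Q :: complex
  assumes "P \<noteq> 0" "Q \<noteq> 0" "P \<noteq> 1" "Q \<noteq> 1" "P \<noteq> Q"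
  shows "1 / ((1 - P) * (1 - Q)) = 1 / ((1 - P / Q) * (1 - Q)) + 1 / ((1 - Q / P) * (1 - P))"
proof -
  have "1 / ((1 - P / Q) * (1 - Q)) = Q / ((Q - P) * (1 - Q))"
       "1 / ((1 - Q / P) * (1 - P)) = - (P / ((Q - P) * (1 - P)))"
    using assms by (auto simp: divide_simps) (auto simp: algebra_simps)
  moreover have "1 - P \<noteq> 0" "1 - Q \<noteq> 0" "Q - P \<noteq> 0" using assms by auto
  moreover from this have "Q / ((Q - P) * (1 - Q)) - P / ((Q - P) * (1 - P)) =
      (Q * (1 - P) - P * (1 - Q)) / ((Q - P) * ((1 - P) * (1 - Q)))"
    by (simp add: divide_simps)
  moreover have "Q * (1 - P) - P * (1 - Q) = Q - P" by (simp add: algebra_simps)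
  ultimately show ?thesis by simp
qed

text \<open>The double series of \<open>J(x y) J(x)\<close> with indices \<open>m\<close>,
  \<open>n\<close> is rewritten by \<open>a = m + n\<close>, \<open>b = m\<close>. Nonzero
  \<open>m\<close>, \<open>n\<close> mean \<open>b\<close> nonzero and \<open>a\<close> different
  from \<open>b\<close>; the remaining line \<open>a = 0\<close> has to be removed.\<close>

lemma has_sum_off_diagonal:
  fixes p x y :: complex
  assumes p: "0 < norm p" and x: "norm x < 1" and y: "norm y < 1" and xy: "norm p < norm (x * y)"
  shows "((\<lambda>(a, b). x powi a * y powi b / ((1 - p powi (a - b)) * (1 - p powi b)))
           has_sum (bilateral_lambert p (x * y) * bilateral_lambert p x + bilateral_lambert2 p y))
           {(a, b). a \<noteq> 0 \<and> b \<noteq> 0 \<and> a \<noteq> (b :: int)}"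
proof -
  have nz: "x \<noteq> 0" "y \<noteq> 0" "p \<noteq> 0" using p xy by auto
  have x': "norm p < norm x"
    using xy y mult_left_mono[of "norm y" 1 "norm x"] by (simp add: norm_mult)
  have y': "norm p < norm y"
    using xy x mult_right_mono[of "norm x" 1 "norm y"] by (simp add: norm_mult)
  have xy1: "norm (x * y) < 1"
    using x y mult_left_mono[of "norm y" 1 "norm x"] by (simp add: norm_mult)
  have p1: "norm p < 1" using x x' by simp
  note ne = one_minus_powi_nonzero[OF p p1]
  define N where "N = -{0::int}"
  let ?f = "\<lambda>(m, n). ((x * y) powi m / (1 - p powi m)) * (x powi n / (1 - p powi n))"
  have "(?f has_sum (bilateral_lambert p (x * y) * bilateral_lambert p x)) (N \<times> N)"
    unfolding N_def
    by (intro has_sum_product abs_summable_bilateral_lambert has_sum_bilateral_lambert p x x' xy xy1)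
  \<comment> \<open>The line \<open>a = 0\<close> is \<open>n = -m\<close>; there the powers of
    \<open>x\<close> cancel and
    \<open>1 / ((1 - p^m) (1 - p^(-m))) = - p^m / (1 - p^m)^2\<close>.\<close>
  moreover have "(?f has_sum (- bilateral_lambert2 p y)) ((\<lambda>m. (m, -m)) ` N)"
  proof (subst has_sum_reindex)
    have "((\<lambda>n. - (y powi n * p powi n / (1 - p powi n)\<^sup>2)) has_sum (- bilateral_lambert2 p y)) N"
      unfolding N_def by (intro has_sum_uminusI has_sum_bilateral_lambert2 p y y')
    also have "?this \<longleftrightarrow> ((?f \<circ> (\<lambda>m. (m, -m))) has_sum (- bilateral_lambert2 p y)) N"
    proof (rule has_sum_cong)
      fix n assume "n \<in> N"
      hence "1 - p powi n \<noteq> 0" "1 - p powi (-n) \<noteq> 0"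
        using ne by (auto simp: N_def)
      moreover have "p powi n \<noteq> 0" "x powi n \<noteq> 0" using nz by auto
      ultimately show "- (y powi n * p powi n / (1 - p powi n)\<^sup>2) = (?f \<circ> (\<lambda>m. (m, -m))) n"
        by (simp add: power_int_minus power_int_mult_distrib divide_simps power2_eq_square)
           (simp add: algebra_simps)
    qed
    finally show "((?f \<circ> (\<lambda>m. (m, -m))) has_sum (- bilateral_lambert2 p y)) N" .
  qed (auto simp: inj_on_def)
  ultimately have "(?f has_sum (bilateral_lambert p (x * y) * bilateral_lambert p x
      - (- bilateral_lambert2 p y))) (N \<times> N - (\<lambda>m. (m, -m)) ` N)"
    by (rule has_sum_diff_subset) (auto simp: N_def)
  thus ?thesis
    by (rule iffD1[OF has_sum_reindex_bij_witness[of _ "\<lambda>(a, b). (b, a - b)" "\<lambda>(m, n). (m + n, m)"], rotated -1])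
       (use nz in \<open>auto simp: N_def power_int_add power_int_mult_distrib mult_ac image_iff\<close>)
qed

text \<open>
  Comparison of the coefficients of \<open>x\<^sup>a y\<^sup>b\<close>: off the lines \<open>a = 0\<close>, \<open>b = 0\<close>, \<open>a = b\<close> everything cancels
  by \<open>partial_fractions\<close>, and each of the three lines contributes a value of the second series.
\<close>

lemma bilateral_lambert_addition:
  fixes p x y :: complex
  assumes p: "0 < norm p" and x: "norm x < 1" and y: "norm y < 1" and xy: "norm p < norm (x * y)"
  defines "J \<equiv> bilateral_lambert p" and "T \<equiv> bilateral_lambert2 p"
  shows "J x * J y - J (x * y) * (J x + J y) = J (x * y) + T (x * y) + T x + T y"
proof -
  have nz: "x \<noteq> 0" "y \<noteq> 0" "p \<noteq> 0" using p xy by auto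
  have x': "norm p < norm x"
    using xy y mult_left_mono[of "norm y" 1 "norm x"] by (simp add: norm_mult)
  have y': "norm p < norm y"
    using xy x mult_right_mono[of "norm x" 1 "norm y"] by (simp add: norm_mult)
  have xy1: "norm (x * y) < 1"
    using x y mult_left_mono[of "norm y" 1 "norm x"] by (simp add: norm_mult)
  have p1: "norm p < 1" using x x' by simp
  note ne = one_minus_powi_nonzero[OF p p1]
  have ne1: "p powi n \<noteq> 1" if "n \<noteq> 0" for n using ne[OF that] by auto
  let ?u = "\<lambda>x n. x powi n / (1 - p powi n)"
  note S = has_sum_product[OF abs_summable_bilateral_lambert abs_summable_bilateral_lambert
      has_sum_bilateral_lambert has_sum_bilateral_lambert, OF p _ _ p _ _ p _ _ p]
  define N where "N = -{0::int}"
  define D where "D = {(a, b). a \<noteq> (0::int) \<and> b \<noteq> (0::int) \<and> a \<noteq> b}"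

  have "((\<lambda>(a, b). ?u x a * ?u y b) has_sum (J x * J y)) (N \<times> N)"
    unfolding J_def N_def using S x x' y y' by blast
  \<comment> \<open>On the diagonal,
    \<open>1 / (1 - p^n)^2 = 1 / (1 - p^n) + p^n / (1 - p^n)^2\<close> produces both series at
    \<open>x * y\<close>.\<close>
  moreover have "((\<lambda>(a, b). ?u x a * ?u y b) has_sum (J (x * y) + T (x * y))) ((\<lambda>n. (n, n)) ` N)"
  proof (subst has_sum_reindex)
    have "((\<lambda>n. ?u (x * y) n + (x * y) powi n * p powi n / (1 - p powi n)\<^sup>2)
        has_sum (J (x * y) + T (x * y))) N"
      unfolding J_def T_def N_def
      by (intro has_sum_add has_sum_bilateral_lambert has_sum_bilateral_lambert2 p xy xy1)
    also have "?this \<longleftrightarrow> (((\<lambda>(a, b). ?u x a * ?u y b) \<circ> (\<lambda>n. (n, n))) has_sum (J (x * y) + T (x * y))) N"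
    proof (rule has_sum_cong)
      fix n assume "n \<in> N"
      hence "1 - p powi n \<noteq> 0" using ne by (auto simp: N_def)
      thus "?u (x * y) n + (x * y) powi n * p powi n / (1 - p powi n)\<^sup>2 =
          ((\<lambda>(a, b). ?u x a * ?u y b) \<circ> (\<lambda>n. (n, n))) n"
        by (simp add: power_int_mult_distrib divide_simps power2_eq_square) (simp add: algebra_simps)
    qed
    finally show "(((\<lambda>(a, b). ?u x a * ?u y b) \<circ> (\<lambda>n. (n, n))) has_sum (J (x * y) + T (x * y))) N" .
  qed (auto simp: inj_on_def)
  ultimately have "((\<lambda>(a, b). ?u x a * ?u y b) has_sum (J x * J y - (J (x * y) + T (x * y))))
      (N \<times> N - (\<lambda>n. (n, n)) ` N)"
    by (rule has_sum_diff_subset) auto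
  also have "N \<times> N - (\<lambda>n. (n, n)) ` N = D" by (auto simp: N_def D_def)
  finally have 1: "((\<lambda>(a, b). ?u x a * ?u y b) has_sum (J x * J y - (J (x * y) + T (x * y)))) D" .

  have "((\<lambda>(a, b). x powi a * y powi b / ((1 - p powi (a - b)) * (1 - p powi b)))
          has_sum (J (x * y) * J x + T y)) D"
    unfolding J_def T_def D_def by (rule has_sum_off_diagonal) (fact p x y xy)+
  \<comment> \<open>The same formula with \<open>x\<close> and \<open>y\<close> exchanged; swapping
    \<open>a\<close> and \<open>b\<close> afterwards restores the monomial
    \<open>x^a y^b\<close>.\<close>
  moreover have "((\<lambda>(a, b). y powi a * x powi b / ((1 - p powi (a - b)) * (1 - p powi b)))
          has_sum (J (y * x) * J y + T x)) D"
    unfolding J_def T_def D_def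
    by (rule has_sum_off_diagonal) (use p x y xy in \<open>auto simp: mult.commute\<close>)
  hence "((\<lambda>(a, b). x powi a * y powi b / ((1 - p powi (b - a)) * (1 - p powi a)))
          has_sum (J (y * x) * J y + T x)) D"
    by (rule iffD1[OF has_sum_reindex_bij_witness[of _ prod.swap prod.swap], rotated -1])
       (auto simp: D_def mult_ac)
  ultimately have "((\<lambda>t. (\<lambda>(a, b). x powi a * y powi b / ((1 - p powi (a - b)) * (1 - p powi b))) t
       + (\<lambda>(a, b). x powi a * y powi b / ((1 - p powi (b - a)) * (1 - p powi a))) t)
       has_sum ((J (x * y) * J x + T y) + (J (y * x) * J y + T x))) D"
    by (rule has_sum_add)
  also have "?this \<longleftrightarrow> ((\<lambda>(a, b). ?u x a * ?u y b) has_sum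
       ((J (x * y) * J x + T y) + (J (y * x) * J y + T x))) D"
  proof (rule has_sum_cong, clarify)
    fix a b assume "(a, b) \<in> D"
    hence ab: "a \<noteq> 0" "b \<noteq> 0" "a \<noteq> b" by (auto simp: D_def)
    have "p powi a \<noteq> p powi b"
      using ne1[of "a - b"] ab nz by (auto simp: power_int_diff)
    with partial_fractions[of "p powi a" "p powi b"] ne1 nz ab
    have eq: "1 / ((1 - p powi a) * (1 - p powi b)) =
        1 / ((1 - p powi (a - b)) * (1 - p powi b)) + 1 / ((1 - p powi (b - a)) * (1 - p powi a))"
      by (simp add: power_int_diff)
    have "x powi a * y powi b / ((1 - p powi (a - b)) * (1 - p powi b))
        + x powi a * y powi b / ((1 - p powi (b - a)) * (1 - p powi a)) =
        x powi a * y powi b * (1 / ((1 - p powi (a - b)) * (1 - p powi b))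
          + 1 / ((1 - p powi (b - a)) * (1 - p powi a)))"
      by (simp add: distrib_left)
    also have "\<dots> = ?u x a * ?u y b" unfolding eq[symmetric] by simp
    finally show "x powi a * y powi b / ((1 - p powi (a - b)) * (1 - p powi b))
        + x powi a * y powi b / ((1 - p powi (b - a)) * (1 - p powi a)) = ?u x a * ?u y b" .
  qed
  finally have "J x * J y - (J (x * y) + T (x * y)) = (J (x * y) * J x + T y) + (J (y * x) * J y + T x)"
    using 1 has_sum_unique by blast
  thus ?thesis by (simp add: algebra_simps)
qed

section \<open>One-sided Lambert series and residue classes\<close>

lemma norm_divide_one_minus_power_le:
  fixes p :: complex
  assumes "norm p < 1" "n > 0"
  shows "norm (x / (1 - p ^ n)) \<le> norm x / (1 - norm p)"
proof -
  have "norm p ^ n \<le> norm p ^ 1" using assms by (intro power_decreasing) auto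
  moreover have "norm (1::complex) - norm (p ^ n) \<le> norm (1 - p ^ n)" by (rule norm_triangle_ineq2)
  ultimately have "1 - norm p \<le> norm (1 - p ^ n)" by (simp add: norm_power)
  thus ?thesis unfolding norm_divide using assms by (intro frac_le) auto
qed

text \<open>Expand \<open>1 / (1 - p^n)\<close> as a geometric series in \<open>p^n\<close> and sum
  over \<open>n\<close> first; absolute convergence of the double series permits the
  exchange.\<close>

lemma lambert_swap:
  fixes p z :: complex
  assumes p: "norm p < 1" and z: "norm z < 1"
  shows "(\<Sum>\<^sub>\<infinity>n\<in>{1..}. z ^ n / (1 - p ^ n)) = (\<Sum>\<^sub>\<infinity>k. z * p ^ k / (1 - z * p ^ k))"
proof -
  have geo: "(\<lambda>k. r ^ k) summable_on A" if "0 \<le> r" "r < 1" for r :: real and A :: "nat set"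
    by (rule summable_on_subset[of _ UNIV])
       (use that in \<open>auto intro!: norm_summable_imp_summable_on simp: summable_geometric\<close>)
  have "(\<lambda>x. norm ((\<lambda>(n, k). z ^ n * (p ^ n) ^ k) x)) summable_on ({1..} \<times> UNIV)"
  proof (rule Infinite_Sum.abs_summable_on_comparison_test')
    have "(\<lambda>x. norm ((\<lambda>(n, k). norm z ^ n * norm p ^ k) x)) summable_on Sigma {1..} (\<lambda>_. UNIV)"
    proof (rule summable_on_SigmaI)
      show "((\<lambda>k. norm ((\<lambda>(n, k). norm z ^ n * norm p ^ k) (n, k))) has_sum
          (norm z ^ n * infsum (\<lambda>k. norm p ^ k) UNIV)) UNIV" for n :: nat
        using has_sum_cmult_right[OF has_sum_infsum[OF geo[of "norm p" UNIV]], of "norm z ^ n"] p by simp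
      show "(\<lambda>n. norm z ^ n * infsum (\<lambda>k. norm p ^ k) UNIV) summable_on {1..}"
        using z by (intro summable_on_cmult_left geo) auto
    qed auto
    thus "(\<lambda>(n, k). norm z ^ n * norm p ^ k) summable_on ({1::nat..} \<times> (UNIV :: nat set))"
      by (simp add: case_prod_unfold)
    show "norm ((\<lambda>(n, k). z ^ n * (p ^ n) ^ k) x) \<le> (\<lambda>(n, k). norm z ^ n * norm p ^ k) x"
      if "x \<in> {1..} \<times> (UNIV :: nat set)" for x
    proof -
      obtain n k where x: "x = (n, k)" by force
      \<comment> \<open>Since \<open>n >= 1\<close>, the double series is dominated by a product of
        two geometric series.\<close>
      have "norm p ^ (n * k) \<le> norm p ^ k"
        using p that x by (intro power_decreasing) auto
      thus ?thesis by (simp add: x norm_mult norm_power mult_left_mono flip: power_mult)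
    qed
  qed
  hence "(\<lambda>(n, k). z ^ n * (p ^ n) ^ k) summable_on ({1..} \<times> UNIV)"
    by (rule abs_summable_summable)
  hence swap: "(\<Sum>\<^sub>\<infinity>n\<in>{1..}. \<Sum>\<^sub>\<infinity>k. z ^ n * (p ^ n) ^ k) =
      (\<Sum>\<^sub>\<infinity>k. \<Sum>\<^sub>\<infinity>n\<in>{1..}. z ^ n * (p ^ n) ^ k)"
    by (rule infsum_swap_banach)
  have inner1: "(\<Sum>\<^sub>\<infinity>k. z ^ n * (p ^ n) ^ k) = z ^ n / (1 - p ^ n)" if "n \<in> {1..}" for n
  proof -
    have "norm (p ^ n) < 1"
      using p that by (simp add: norm_power power_less_one_iff)
    hence "((\<lambda>k. (p ^ n) ^ k) has_sum (1 / (1 - p ^ n))) UNIV"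
      by (intro norm_summable_imp_has_sum geometric_sums) (simp_all add: norm_power summable_geometric)
    from infsumI[OF has_sum_cmult_right[OF this, of "z ^ n"]] show ?thesis by simp
  qed
  have inner2: "(\<Sum>\<^sub>\<infinity>n\<in>{1..}. z ^ n * (p ^ n) ^ k) = z * p ^ k / (1 - z * p ^ k)" for k
  proof -
    have "norm z * norm p ^ k \<le> norm z * 1"
      using p by (intro mult_left_mono power_le_one) auto
    hence "norm (z * p ^ k) < 1" using z by (simp add: norm_mult norm_power)
    from infsumI[OF has_sum_geometric_from_1[OF this]] show ?thesis
      by (simp add: power_mult_distrib mult.commute flip: power_mult)
  qed
  have "(\<Sum>\<^sub>\<infinity>n\<in>{1..}. z ^ n / (1 - p ^ n)) = (\<Sum>\<^sub>\<infinity>n\<in>{1..}. \<Sum>\<^sub>\<infinity>k. z ^ n * (p ^ n) ^ k)"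
    by (rule infsum_cong) (rule inner1[symmetric])
  thus ?thesis unfolding swap inner2 .
qed

text \<open>The right-hand side is minus the logarithmic derivative \<open>x * d/dx\<close> of the
  theta product with factors \<open>(1 - x p^k) (1 - p^(k+1) / x)\<close>. The two sums come from
  the positive and the negative indices, each treated by \<open>lambert_swap\<close>.\<close>

lemma bilateral_lambert_eq:
  fixes p x :: complex
  assumes "0 < norm p" "norm p < norm x" "norm x < 1"
  shows "bilateral_lambert p x =
    (\<Sum>\<^sub>\<infinity>k. x * p ^ k / (1 - x * p ^ k)) - (\<Sum>\<^sub>\<infinity>k. (p / x) * p ^ k / (1 - (p / x) * p ^ k))"
proof -
  have p1: "norm p < 1" and x0: "x \<noteq> 0" using assms by auto
  let ?f = "\<lambda>n::int. x powi n / (1 - p powi n)"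
  have sub: "int ` {1..} \<subseteq> -{0}" "(\<lambda>n. - int n) ` {1..} \<subseteq> -{0}" by auto
  have "?f summable_on -{0}"
    using has_sum_bilateral_lambert[OF assms] by (auto simp: summable_on_def)
  note summ = summable_on_subset[OF this sub(1)] summable_on_subset[OF this sub(2)]
  have "-{0::int} = int ` {1..} \<union> (\<lambda>n. - int n) ` {1..}"
  proof -
    have "z \<in> int ` {1..} \<union> (\<lambda>n. - int n) ` {1..}" if "z \<noteq> 0" for z
      using that by (cases z rule: int_cases) force+
    thus ?thesis by auto
  qed
  hence "bilateral_lambert p x = infsum ?f (int ` {1..}) + infsum ?f ((\<lambda>n. - int n) ` {1..})"
    unfolding bilateral_lambert_def by (simp only:) (rule infsum_Un_disjoint[OF summ], auto)
  also have "infsum ?f (int ` {1..}) = (\<Sum>\<^sub>\<infinity>n\<in>{1..}. x ^ n / (1 - p ^ n))"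
    by (subst infsum_reindex) (auto simp: o_def)
  also have "\<dots> = (\<Sum>\<^sub>\<infinity>k. x * p ^ k / (1 - x * p ^ k))"
    by (rule lambert_swap) (use assms p1 in auto)
  also have "infsum ?f ((\<lambda>n. - int n) ` {1..}) = (\<Sum>\<^sub>\<infinity>n\<in>{1..}. - ((p / x) ^ n / (1 - p ^ n)))"
  proof (subst infsum_reindex, simp add: inj_on_def, rule infsum_cong)
    fix n :: nat assume "n \<in> {1..}"
    hence "- int n \<noteq> 0" by auto
    from powi_neg_div[OF assms(1) p1 x0 this]
    show "(?f \<circ> (\<lambda>n. - int n)) n = - ((p / x) ^ n / (1 - p ^ n))"
      unfolding o_def minus_minus power_int_of_nat by (metis minus_minus)
  qed
  also have "\<dots> = - (\<Sum>\<^sub>\<infinity>n\<in>{1..}. (p / x) ^ n / (1 - p ^ n))"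
    by (rule infsum_uminus)
  also have "(\<Sum>\<^sub>\<infinity>n\<in>{1..}. (p / x) ^ n / (1 - p ^ n)) =
      (\<Sum>\<^sub>\<infinity>k. (p / x) * p ^ k / (1 - (p / x) * p ^ k))"
    by (rule lambert_swap) (use norm_annulus_reflect[OF assms] p1 in auto)
  finally show ?thesis by simp
qed

lemma summable_on_lambert:
  fixes q :: complex
  assumes "norm q < 1" "\<And>n. norm (a n) \<le> C"
  shows "(\<lambda>n. a n * (q ^ n / (1 - q ^ n))) summable_on UNIV"
proof (rule abs_summable_summable, rule Infinite_Sum.abs_summable_on_comparison_test')
  have "(\<lambda>n. norm q ^ n) summable_on UNIV"
    using assms by (intro norm_summable_imp_summable_on) (simp add: summable_geometric)
  from summable_on_cmult_right[OF this]
  show "(\<lambda>n. C / (1 - norm q) * norm q ^ n) summable_on UNIV" .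
  fix n :: nat
  have C: "0 \<le> C" using assms(2)[of 0] norm_ge_zero order_trans by blast
  \<comment> \<open>At \<open>n = 0\<close> the quotient is \<open>1 / 0 = 0\<close>, so the index 0
    does no harm.\<close>
  have "norm (q ^ n / (1 - q ^ n)) \<le> norm q ^ n / (1 - norm q)"
    using norm_divide_one_minus_power_le[OF assms(1), of n "q ^ n"] assms(1)
    by (cases "n = 0") (auto simp: norm_power)
  hence "norm (a n) * norm (q ^ n / (1 - q ^ n)) \<le> C * (norm q ^ n / (1 - norm q))"
    using assms C by (intro mult_mono) auto
  thus "norm (a n * (q ^ n / (1 - q ^ n))) \<le> C / (1 - norm q) * norm q ^ n"
    unfolding norm_mult[of "a n"] by simp
qed

lemma infsum_residue_classes:
  fixes chi f :: "nat \<Rightarrow> complex"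
  assumes N: "N > 0" and per: "\<And>r k. chi (r + N * k) = chi r"
    and summ: "(\<lambda>n. chi n * f n) summable_on UNIV" "\<And>r. (\<lambda>k. f (r + N * k)) summable_on UNIV"
  shows "(\<Sum>\<^sub>\<infinity>n. chi n * f n) = (\<Sum>r<N. chi r * (\<Sum>\<^sub>\<infinity>k. f (r + N * k)))"
proof -
  have bij: "bij_betw (\<lambda>(r, k). r + N * k) ({..<N} \<times> UNIV) UNIV"
    by (rule bij_betwI[of _ _ _ "\<lambda>n. (n mod N, n div N)"]) (use N in auto)
  have "((\<lambda>x. (\<lambda>n. chi n * f n) ((\<lambda>(r, k). r + N * k) x)) has_sum (\<Sum>\<^sub>\<infinity>n. chi n * f n)) ({..<N} \<times> UNIV)"
    using has_sum_infsum[OF summ(1)]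
    by (rule iffD2[OF has_sum_reindex_bij_betw[OF bij, where f = "\<lambda>n. chi n * f n"]])
  hence "((\<lambda>r. chi r * (\<Sum>\<^sub>\<infinity>k. f (r + N * k))) has_sum (\<Sum>\<^sub>\<infinity>n. chi n * f n)) {..<N}"
    by (rule has_sum_Sigma') (use has_sum_cmult_right[OF has_sum_infsum[OF summ(2)]] per in simp)
  moreover have "((\<lambda>r. chi r * (\<Sum>\<^sub>\<infinity>k. f (r + N * k))) has_sum
      (\<Sum>r<N. chi r * (\<Sum>\<^sub>\<infinity>k. f (r + N * k)))) {..<N}"
    by (rule has_sum_finite) simp
  ultimately show ?thesis using has_sum_unique by blast
qed

text \<open>For \<open>p = q^N\<close> and \<open>x = q^r\<close> one has
  \<open>p / x = q^(N - r)\<close>, so the two one-sided series collect the exponents congruent to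
  \<open>r\<close> and to \<open>-r\<close> modulo \<open>N\<close>.\<close>

lemma bilateral_lambert_powers:
  fixes q :: complex
  assumes q: "0 < norm q" "norm q < 1" and r: "0 < r" "r < N"
  shows "norm (q ^ N) < norm (q ^ r)" "norm (q ^ r) < 1"
    "bilateral_lambert (q ^ N) (q ^ r) =
      (\<Sum>\<^sub>\<infinity>k. q ^ (r + N * k) / (1 - q ^ (r + N * k)))
       - (\<Sum>\<^sub>\<infinity>k. q ^ (N - r + N * k) / (1 - q ^ (N - r + N * k)))"
proof -
  show 1: "norm (q ^ N) < norm (q ^ r)"
    using q r by (auto simp: norm_power intro!: power_strict_decreasing)
  show 2: "norm (q ^ r) < 1"
    using q r by (simp add: norm_power power_less_one_iff)
  have "q ^ N / q ^ r = q ^ (N - r)" using q r by (auto simp: power_diff)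
  with bilateral_lambert_eq[OF _ 1 2] q show "bilateral_lambert (q ^ N) (q ^ r) =
      (\<Sum>\<^sub>\<infinity>k. q ^ (r + N * k) / (1 - q ^ (r + N * k)))
       - (\<Sum>\<^sub>\<infinity>k. q ^ (N - r + N * k) / (1 - q ^ (N - r + N * k)))"
    by (simp add: power_add power_mult)
qed

section \<open>Values of Dirichlet series at zero\<close>

text \<open>Two continuations agree for \<open>Re z > 1\<close>, hence on the smaller of their
  half-planes, which is connected and contains \<open>s\<close>. This gives the uniqueness that the
  description operator needs.\<close>

lemma dirichlet_L_eqI:
  assumes c: "c \<le> 1" "c < Re s" and f: "f holomorphic_on {z. c < Re z}"
    and sums: "\<And>z. 1 < Re z \<Longrightarrow> (\<lambda>n. chi (int (Suc n)) * of_nat (Suc n) powr (- z)) sums f z"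
  shows "dirichlet_L chi s = f s"
  unfolding dirichlet_L_def
proof (rule the_equality)
  show "\<exists>c g. c \<le> 1 \<and> c < Re s \<and> g holomorphic_on {z. c < Re z} \<and>
     (\<forall>z. 1 < Re z \<longrightarrow> (\<lambda>n. chi (int (Suc n)) * of_nat (Suc n) powr (- z)) sums g z) \<and> f s = g s"
    using assms by blast
next
  fix w assume "\<exists>c f. c \<le> 1 \<and> c < Re s \<and> f holomorphic_on {z. c < Re z} \<and>
     (\<forall>z. 1 < Re z \<longrightarrow> (\<lambda>n. chi (int (Suc n)) * of_nat (Suc n) powr (- z)) sums f z) \<and> w = f s"
  then obtain c' g where c': "c' \<le> 1" "c' < Re s" and g: "g holomorphic_on {z. c' < Re z}"
    and sums': "\<And>z. 1 < Re z \<Longrightarrow> (\<lambda>n. chi (int (Suc n)) * of_nat (Suc n) powr (- z)) sums g z"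
    and w: "w = g s" by blast
  let ?S = "{z. max c c' < Re z}"
  have "g s = f s"
  proof (rule analytic_continuation_open[where f = g and g = f and s = "{z. 1 < Re z}" and s' = ?S])
    show "open {z. 1 < Re z}" "open ?S" by (rule open_halfspace_Re_gt)+
    have "(2 :: complex) \<in> {z. 1 < Re z}" by simp
    thus "{z. 1 < Re z} \<noteq> {}" by blast
    show "connected ?S" by (intro convex_connected convex_halfspace_Re_gt)
    show "f holomorphic_on ?S" "g holomorphic_on ?S"
      using f g by (auto elim: holomorphic_on_subset)
    show "g z = f z" if "z \<in> {z. 1 < Re z}" for z
      using sums sums' that sums_unique2 by blast
  qed (use c c' in auto)
  with w show "w = f s" by simp
qed

section \<open>Differences of complex powers along a real ray\<close>

context
  fixes m :: real
  assumes m: "0 < m"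
begin

lemma powr_real_ray_bound:
  assumes "z \<in> of_real ` {m..}" "Re w \<le> 0"
  shows "norm (z powr w) \<le> m powr Re w"
  using assms m by (auto simp: norm_powr_real_powr intro!: powr_mono2')

lemma convex_real_ray: "convex ((of_real :: real \<Rightarrow> complex) ` {m..})"
  by (intro convex_linear_image bounded_linear.linear bounded_linear_of_real) auto

lemma powr_diff_has_derivative:
  assumes "z \<in> (of_real :: real \<Rightarrow> complex) ` {m..}"
  shows "((\<lambda>z. z powr w) has_field_derivative (w * z powr (w - 1))) (at z within A)"
    "((\<lambda>z. z powr w - (z + 1) powr w) has_field_derivative
        (w * (z powr (w - 1) - (z + 1) powr (w - 1)))) (at z within A)"
proof -
  have *: "z \<notin> \<real>\<^sub>\<le>\<^sub>0" "z + 1 \<notin> \<real>\<^sub>\<le>\<^sub>0" using assms m by (auto simp: complex_nonpos_Reals_iff)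
  show "((\<lambda>z. z powr w) has_field_derivative (w * z powr (w - 1))) (at z within A)"
    using has_field_derivative_powr[OF *(1)] has_field_derivative_at_within by blast
  have "((\<lambda>z. (z + 1) powr w) has_field_derivative (w * (z + 1) powr (w - 1) * 1)) (at z within A)"
    using * by (auto intro!: derivative_eq_intros)
  with \<open>((\<lambda>z. z powr w) has_field_derivative (w * z powr (w - 1))) (at z within A)\<close>
  have "((\<lambda>z. z powr w - (z + 1) powr w) has_field_derivative
        (w * z powr (w - 1) - w * (z + 1) powr (w - 1) * 1)) (at z within A)"
    by (rule DERIV_diff)
  thus "((\<lambda>z. z powr w - (z + 1) powr w) has_field_derivative
        (w * (z powr (w - 1) - (z + 1) powr (w - 1)))) (at z within A)"
    by (simp add: right_diff_distrib)
qed

lemma real_ray_plus_one: "z \<in> of_real ` {m..} \<Longrightarrow> z + 1 \<in> (of_real :: real \<Rightarrow> complex) ` {m..}"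
  by (auto simp: image_iff intro!: bexI[of _ "x + 1" for x])

text \<open>The mean value inequality over a step of length 1. The ray from \<open>m\<close> is
  convex and stable under adding 1, and on it the derivative \<open>w * z powr (w - 1)\<close> is
  largest at \<open>m\<close> in norm.\<close>

lemma norm_powr_diff_le:
  assumes "z \<in> of_real ` {m..}" "Re w \<le> 1"
  shows "norm (z powr w - (z + 1) powr w) \<le> norm w * m powr (Re w - 1)"
proof -
  have "norm (z powr w - (z + 1) powr w) \<le> (norm w * m powr (Re w - 1)) * norm (z - (z + 1))"
  proof (rule field_differentiable_bound[OF convex_real_ray])
    fix z :: complex assume z: "z \<in> of_real ` {m..}"
    thus "((\<lambda>z. z powr w) has_field_derivative (w * z powr (w - 1))) (at z within of_real ` {m..})"
      by (rule powr_diff_has_derivative)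
    show "norm (w * z powr (w - 1)) \<le> norm w * m powr (Re w - 1)"
      unfolding norm_mult using powr_real_ray_bound[OF z, of "w - 1"] assms
      by (intro mult_left_mono) auto
  qed (use assms real_ray_plus_one in auto)
  thus ?thesis by simp
qed

text \<open>The derivative of a first difference of \<open>z powr w\<close> is \<open>w\<close>
  times a first difference of \<open>z powr (w - 1)\<close>, so the mean value inequality applies
  once more.\<close>

lemma norm_powr_diff2_le:
  assumes "z \<in> of_real ` {m..}" "Re w \<le> 1"
  shows "norm ((z powr w - (z + 1) powr w) - ((z + 1) powr w - (z + 2) powr w))
           \<le> norm w * norm (w - 1) * m powr (Re w - 2)"
proof -
  let ?g = "\<lambda>z. z powr w - (z + 1) powr w"
  have "norm (?g z - ?g (z + 1)) \<le> (norm w * (norm (w - 1) * m powr (Re w - 2))) * norm (z - (z + 1))"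
  proof (rule field_differentiable_bound[OF convex_real_ray])
    fix z :: complex assume z: "z \<in> of_real ` {m..}"
    thus "(?g has_field_derivative (w * (z powr (w - 1) - (z + 1) powr (w - 1)))) (at z within of_real ` {m..})"
      by (rule powr_diff_has_derivative)
    show "norm (w * (z powr (w - 1) - (z + 1) powr (w - 1))) \<le> norm w * (norm (w - 1) * m powr (Re w - 2))"
      unfolding norm_mult using norm_powr_diff_le[OF z, of "w - 1"] assms
      by (intro mult_left_mono) auto
  qed (use assms real_ray_plus_one in auto)
  thus ?thesis by (simp add: add.assoc)
qed

end

section \<open>Continuation to 0 by repeated partial summation\<close>

lemma sum_by_parts:
  fixes a u :: "nat \<Rightarrow> 'a :: comm_ring"
  shows "(\<Sum>n<M. a n * u n) = (\<Sum>k<M. a k) * u M + (\<Sum>n<M. (\<Sum>k<Suc n. a k) * (u n - u (Suc n)))"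
  by (induction M) (simp_all add: algebra_simps)

lemma tendsto_powr_minus_nat:
  assumes "0 < Re z"
  shows "(\<lambda>n. of_nat (Suc n) powr (- z) :: complex) \<longlonglongrightarrow> 0"
proof (rule tendsto_norm_zero_cancel)
  have "(\<lambda>n. real (Suc n) powr (- Re z)) \<longlonglongrightarrow> 0"
    using assms by (intro tendsto_neg_powr filterlim_compose[OF filterlim_real_sequentially filterlim_Suc]) auto
  thus "(\<lambda>n. norm (of_nat (Suc n) powr (- z) :: complex)) \<longlonglongrightarrow> 0"
    by (simp add: norm_powr_real_powr)
qed

text \<open>
  Summing by parts twice leaves second differences of \<open>n\<^sup>-\<^sup>s\<close>, which converge for \<open>Re s > -1\<close> and
  vanish at \<open>s = 0\<close>.
\<close>

lemma dirichlet_L_0_eqI: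
  fixes chi :: "int \<Rightarrow> complex" and w :: complex
  defines "A \<equiv> \<lambda>n. \<Sum>k<n. chi (int (Suc k))"
  assumes A: "\<And>n. norm (A n) \<le> K" and B: "\<And>n. norm (\<Sum>k<n. A (Suc k) - w) \<le> K"
  shows "dirichlet_L chi 0 = w"
proof -
  define B where "B = (\<lambda>n. \<Sum>k<n. A (Suc k) - w)"
  define u where "u = (\<lambda>(s::complex) n. of_nat (Suc n) powr (- s) :: complex)"
  define d where "d = (\<lambda>s n. u s n - u s (Suc n))"
  define e where "e = (\<lambda>s n. B (Suc n) * (d s n - d s (Suc n)))"
  \<comment> \<open>The candidate continuation: what remains for \<open>Re s > 1\<close> when the
    boundary terms of both summations by parts tend to 0.\<close>
  define f where "f = (\<lambda>s. w + (\<Sum>n. e s n))"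
  have K: "0 \<le> K" using norm_ge_zero[of "A 0"] A[of 0] by linarith
  \<comment> \<open>Second differences have size \<open>n powr (- Re s - 2)\<close>. The restriction
    \<open>Re s > -1/2\<close> leaves 0 inside the half-plane and replaces this by the summable
    power \<open>-3/2\<close>.\<close>
  have bound: "norm (e s n) \<le> K * (norm s * (norm s + 1)) * real (Suc n) powr (- 3 / 2)"
    if "Re s > -1/2" for s n
  proof -
    have "norm (d s n - d s (Suc n)) \<le> norm (-s) * norm (-s - 1) * real (Suc n) powr (Re (-s) - 2)"
      using norm_powr_diff2_le[of "real (Suc n)" "of_real (real (Suc n))" "-s", OF _ imageI] that
      by (simp add: d_def u_def add_ac)
    also have "norm (-s - 1) \<le> norm s + 1"
      using norm_triangle_ineq4[of "-s" 1] by simp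
    also have "real (Suc n) powr (Re (-s) - 2) \<le> real (Suc n) powr (- 3 / 2)"
      by (rule powr_mono) (use that in \<open>simp_all add: field_simps\<close>)
    finally have "norm (d s n - d s (Suc n)) \<le> norm s * (norm s + 1) * real (Suc n) powr (- 3 / 2)"
      by (simp add: mult_left_mono mult_right_mono)
    moreover have "norm (B (Suc n)) \<le> K" using B unfolding B_def by blast
    ultimately show ?thesis
      unfolding e_def norm_mult mult.assoc using K
      by (intro mult_mono) (auto simp: mult.assoc)
  qed
  have summ: "summable (\<lambda>n. real (Suc n) powr (- 3 / 2))"
    using summable_real_powr_iff[of "-3/2"] summable_Suc_iff[of "\<lambda>n. real n powr (- 3 / 2)"] by simp
  have e_summable: "summable (e s)" if "Re s > -1/2" for s
    using summable_comparison_test'[OF summable_mult[OF summ] bound[OF that]] .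
  have holo: "f holomorphic_on {z. -1/2 < Re z}"
  proof (rule holomorphic_uniform_sequence)
    show "open {z. -1/2 < Re z}" by (rule open_halfspace_Re_gt)
    show "(\<lambda>s. w + (\<Sum>n<M. e s n)) holomorphic_on {z. -1/2 < Re z}" for M
      unfolding e_def d_def u_def by (intro holomorphic_intros)
    fix x assume x: "x \<in> {z. -1/2 < Re z}"
    \<comment> \<open>Half the distance from \<open>x\<close> to the boundary line, so the closed
      disc stays inside the half-plane.\<close>
    define r where "r = (Re x + 1/2) / 2"
    have r: "r > 0" using x by (simp add: r_def)
    have sub: "cball x r \<subseteq> {z. -1/2 < Re z}"
    proof
      fix z assume "z \<in> cball x r"
      hence "Re (x - z) \<le> r" using complex_Re_le_cmod[of "x - z"] by (simp add: dist_norm)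
      thus "z \<in> {z. -1/2 < Re z}" using x by (simp add: r_def field_simps)
    qed
    have "uniform_limit (cball x r) (\<lambda>M s. \<Sum>n<M. e s n) (\<lambda>s. \<Sum>n. e s n) sequentially"
    proof (rule Weierstrass_m_test)
      let ?R = "norm x + r"
      show "summable (\<lambda>n. K * (?R * (?R + 1)) * real (Suc n) powr (- 3 / 2))"
        by (rule summable_mult[OF summ])
      fix n s assume s: "s \<in> cball x r"
      have "norm s \<le> ?R"
        using s norm_triangle_ineq2[of s x] by (simp add: dist_norm norm_minus_commute)
      hence "K * (norm s * (norm s + 1)) * real (Suc n) powr (- 3 / 2)
          \<le> K * (?R * (?R + 1)) * real (Suc n) powr (- 3 / 2)"
        using K r by (intro mult_right_mono mult_left_mono mult_mono) auto
      with bound[of s n] s sub show "norm (e s n) \<le> K * (?R * (?R + 1)) * real (Suc n) powr (- 3 / 2)"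
        by fastforce
    qed
    hence "uniform_limit (cball x r) (\<lambda>M s. w + (\<Sum>n<M. e s n)) f sequentially"
      unfolding f_def by (intro uniform_limit_intros)
    with r sub show "\<exists>d>0. cball x d \<subseteq> {z. -1/2 < Re z} \<and>
        uniform_limit (cball x d) (\<lambda>M s. w + (\<Sum>n<M. e s n)) f sequentially" by blast
  qed
  have sums: "(\<lambda>n. chi (int (Suc n)) * of_nat (Suc n) powr (- z)) sums f z" if z: "1 < Re z" for z
  proof -
    have part: "(\<Sum>n<M. chi (int (Suc n)) * u z n) =
        A M * u z M + w * (1 - u z M) + B M * d z M + (\<Sum>n<M. e z n)" for M
    proof -
      have "(\<Sum>n<M. chi (int (Suc n)) * u z n) = A M * u z M + (\<Sum>n<M. A (Suc n) * d z n)"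
        unfolding A_def d_def by (rule sum_by_parts)
      \<comment> \<open>Splitting off \<open>w\<close> isolates a telescoping sum; the rest has
        bounded partial sums \<open>B\<close> and can be summed by parts again.\<close>
      also have "(\<Sum>n<M. A (Suc n) * d z n) = (\<Sum>n<M. (A (Suc n) - w) * d z n) + w * (\<Sum>n<M. d z n)"
        by (simp add: sum_distrib_left flip: sum.distrib) (simp add: algebra_simps)
      also have "(\<Sum>n<M. d z n) = 1 - u z M"
        unfolding d_def by (subst sum_lessThan_telescope') (simp add: u_def)
      also have "(\<Sum>n<M. (A (Suc n) - w) * d z n) = B M * d z M + (\<Sum>n<M. e z n)"
        unfolding B_def e_def by (rule sum_by_parts)
      finally show ?thesis by (simp add: algebra_simps)
    qed
    have u0: "u z \<longlonglongrightarrow> 0" unfolding u_def by (rule tendsto_powr_minus_nat) (use z in auto)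
    have d0: "d z \<longlonglongrightarrow> 0"
      unfolding d_def using tendsto_diff[OF u0 LIMSEQ_Suc[OF u0]] by simp
    have null: "(\<lambda>M. C M * v M) \<longlonglongrightarrow> 0"
      if "\<And>M. norm (C M) \<le> K" "v \<longlonglongrightarrow> 0" for C v :: "nat \<Rightarrow> complex"
    proof (rule Lim_null_comparison)
      show "(\<lambda>M. K * norm (v M)) \<longlonglongrightarrow> 0"
        using tendsto_mult_right_zero[OF tendsto_norm_zero[OF that(2)]] .
      show "\<forall>\<^sub>F M in sequentially. norm (C M * v M) \<le> K * norm (v M)"
        unfolding norm_mult using that(1) by (intro always_eventually allI mult_right_mono) auto
    qed
    have "(\<lambda>M. A M * u z M) \<longlonglongrightarrow> 0" "(\<lambda>M. B M * d z M) \<longlonglongrightarrow> 0"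
      by (rule null, use A B d0 u0 in \<open>auto simp: B_def\<close>)+
    moreover have "(\<lambda>M. \<Sum>n<M. e z n) \<longlonglongrightarrow> (\<Sum>n. e z n)"
      using summable_LIMSEQ[OF e_summable[of z]] z by auto
    ultimately have "(\<lambda>M. A M * u z M + w * (1 - u z M) + B M * d z M + (\<Sum>n<M. e z n))
        \<longlonglongrightarrow> 0 + w * (1 - 0) + 0 + (\<Sum>n. e z n)"
      by (intro tendsto_intros u0)
    thus ?thesis unfolding sums_def f_def part[symmetric] by (simp add: u_def)
  qed
  have "dirichlet_L chi 0 = f 0"
    by (rule dirichlet_L_eqI[OF _ _ holo sums]) auto
  also have "e 0 = (\<lambda>_. 0)" by (simp add: e_def d_def u_def fun_eq_iff del: of_nat_Suc)
  hence "f 0 = w" by (simp add: f_def)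
  finally show ?thesis .
qed

text \<open>Zero sum over one period makes the partial sums periodic, so only those of length below
  \<open>N\<close> need a bound.\<close>

lemma norm_sum_periodic_le:
  fixes f :: "nat \<Rightarrow> complex"
  assumes per: "\<And>n. f (n + N) = f n" and zero: "(\<Sum>k<N. f k) = 0" and N: "N > 0"
  shows "(\<Sum>k<n + N. f k) = (\<Sum>k<n. f k)" "norm (\<Sum>k<n. f k) \<le> (\<Sum>k<N. norm (f k))"
proof -
  show shift: "(\<Sum>k<n + N. f k) = (\<Sum>k<n. f k)" for n
    by (induction n) (simp_all add: zero per)
  show "norm (\<Sum>k<n. f k) \<le> (\<Sum>k<N. norm (f k))"
  proof (induction n rule: less_induct)
    case (less n)
    show ?case
    proof (cases "n < N")
      case True
      have "norm (\<Sum>k<n. f k) \<le> (\<Sum>k<n. norm (f k))" by (rule norm_sum)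
      also have "\<dots> \<le> (\<Sum>k<N. norm (f k))" using True by (intro sum_mono2) auto
      finally show ?thesis .
    next
      case False
      then have "(\<Sum>k<n. f k) = (\<Sum>k<n - N. f k)" using shift[of "n - N"] by simp
      with less[of "n - N"] False N show ?thesis by simp
    qed
  qed
qed

text \<open>The value is the mean of the partial sums over a period. Subtracting this mean gives
  another periodic sequence with zero sum over a period, so \<open>norm_sum_periodic_le\<close>
  supplies both bounds required by \<open>dirichlet_L_0_eqI\<close>.\<close>

lemma dirichlet_L_0_periodic:
  fixes chi :: "int \<Rightarrow> complex"
  assumes per: "\<And>n. chi (n + int N) = chi n" and N: "N > 0"
    and zero: "(\<Sum>k<N. chi (int (Suc k))) = 0"
  shows "dirichlet_L chi 0 = (\<Sum>n<N. \<Sum>k\<le>n. chi (int (Suc k))) / of_nat N"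
proof -
  define A where "A = (\<lambda>n. \<Sum>k<n. chi (int (Suc k)))"
  define w where "w = (\<Sum>n<N. \<Sum>k\<le>n. chi (int (Suc k))) / of_nat N"
  have per': "chi (int (Suc (n + N))) = chi (int (Suc n))" for n
    using per[of "int (Suc n)"] by (simp add: algebra_simps)
  note A_per = norm_sum_periodic_le[of "\<lambda>k. chi (int (Suc k))", OF per' zero N]
  have zeroB: "(\<Sum>k<N. A (Suc k) - w) = 0"
    using N by (simp add: sum_subtractf w_def A_def lessThan_Suc_atMost)
  have perB: "A (Suc (n + N)) - w = A (Suc n) - w" for n using A_per(1)[of "Suc n"] unfolding A_def by (simp only: add_Suc)
  note B_bd = norm_sum_periodic_le(2)[of "\<lambda>k. A (Suc k) - w", OF perB zeroB N]
  show ?thesis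
    unfolding w_def[symmetric]
  proof (rule dirichlet_L_0_eqI)
    fix n
    show "norm (\<Sum>k<n. chi (int (Suc k))) \<le>
        max (\<Sum>k<N. norm (chi (int (Suc k)))) (\<Sum>k<N. norm (A (Suc k) - w))"
      using A_per(2)[of n] by (simp add: A_def)
    show "norm (\<Sum>k<n. (\<Sum>k<Suc k. chi (int (Suc k))) - w) \<le>
        max (\<Sum>k<N. norm (chi (int (Suc k)))) (\<Sum>k<N. norm (A (Suc k) - w))"
      using B_bd[of n] by (simp add: A_def)
  qed
qed

section \<open>Odd characters modulo 11\<close>

lemma odd_dirichlet_characterD:
  assumes "chi \<in> odd_dirichlet_characters N"
  shows "chi (a * b) = chi a * chi b" "[a = b] (mod int N) \<Longrightarrow> chi a = chi b"
    "chi a \<noteq> 0 \<longleftrightarrow> coprime a (int N)" "chi 1 = 1" "chi (- a) = - chi a"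
proof -
  show mult: "chi (a * b) = chi a * chi b" for a b
    using assms by (auto simp: odd_dirichlet_characters_def dirichlet_character_def)
  show "[a = b] (mod int N) \<Longrightarrow> chi a = chi b" "chi a \<noteq> 0 \<longleftrightarrow> coprime a (int N)" for a b
    using assms by (auto simp: odd_dirichlet_characters_def dirichlet_character_def)
  from this(2)[of 1] mult[of 1 1] show "chi 1 = 1" by simp
  have "chi (-1) = -1" using assms by (simp add: odd_dirichlet_characters_def)
  with mult[of "-1" a] show "chi (- a) = - chi a" by simp
qed

text \<open>2 is a primitive root modulo 11, so \<open>chi 2\<close> determines \<open>chi\<close>.
  The exponents come from \<open>8 = 2^3\<close>, congruent to \<open>-3\<close>, from 16, congruent
  to 5, and from \<open>2 * 5\<close>, congruent to \<open>-1\<close>.\<close>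

lemma odd_dirichlet_character_11_values:
  assumes "chi \<in> odd_dirichlet_characters 11"
  shows "chi 0 = 0" "chi 3 = - (chi 2 ^ 3)" "chi 4 = chi 2 ^ 2" "chi 5 = chi 2 ^ 4" "chi 2 ^ 5 = -1"
    "chi 6 = - chi 5" "chi 7 = - chi 4" "chi 8 = - chi 3" "chi 9 = - chi 2" "chi 10 = -1"
proof -
  note D = odd_dirichlet_characterD[OF assms]
  show 0: "chi 0 = 0" using D(3)[of 0] by simp
  have 8: "chi 8 = chi 2 ^ 3"
    using D(1)[of 2 4] D(1)[of 2 2] by (simp add: eval_nat_numeral)
  have neg: "chi 6 = - chi 5" "chi 7 = - chi 4" "chi 8 = - chi 3" "chi 9 = - chi 2" "chi 10 = - chi 1"
    using D(2)[of 6 "-5"] D(2)[of 7 "-4"] D(2)[of 8 "-3"] D(2)[of 9 "-2"] D(2)[of 10 "-1"]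
      D(5)[of 5] D(5)[of 4] D(5)[of 3] D(5)[of 2] D(5)[of 1] by (simp_all add: cong_def)
  thus "chi 6 = - chi 5" "chi 7 = - chi 4" "chi 8 = - chi 3" "chi 9 = - chi 2" "chi 10 = -1"
    using D(4) by simp_all
  show 3: "chi 3 = - (chi 2 ^ 3)" using 8 neg(3) by (metis minus_minus)
  show 4: "chi 4 = chi 2 ^ 2" using D(1)[of 2 2] by (simp add: power2_eq_square)
  have "chi 5 = chi 16" using D(2)[of 5 16] by (simp add: cong_def)
  thus 5: "chi 5 = chi 2 ^ 4" using D(1)[of 2 8] 8 by (simp add: eval_nat_numeral)
  show "chi 2 ^ 5 = -1"
    using D(1)[of 2 5] 5 neg(5) D(4) by (simp add: eval_nat_numeral)
qed

text \<open>Discrete logarithm to the base \<open>2\<close> modulo \<open>11\<close>; the entry for \<open>0\<close> is a dummy.\<close>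

definition ind11 :: "nat \<Rightarrow> nat" where
  "ind11 n = [0, 0, 1, 8, 2, 4, 9, 7, 3, 6, 5] ! n"

lemma ind11_mult:
  "\<forall>i\<in>set [1..<11]. \<forall>j\<in>set [1..<11]. ind11 (i * j mod 11) = (ind11 i + ind11 j) mod 10"
  by code_simp

text \<open>The candidate character with value \<open>z\<close> at the primitive root 2; its value
  at \<open>-1\<close> is \<open>z^5\<close>.\<close>

definition char11 :: "complex \<Rightarrow> int \<Rightarrow> complex" where
  "char11 z a = (if 11 dvd a then 0 else z ^ ind11 (nat (a mod 11)))"

lemma char11_odd_dirichlet_character:
  assumes z: "z ^ 5 = -1"
  shows "char11 z \<in> odd_dirichlet_characters 11"
proof -
  have "z ^ 10 = (z ^ 5) ^ 2" by (simp flip: power_mult)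
  hence z10: "z ^ 10 = 1" using z by simp
  \<comment> \<open>Discrete logarithms add only modulo 10, which is harmless for powers of
    \<open>z\<close>.\<close>
  have zmod: "z ^ (m mod 10) = z ^ m" for m
  proof -
    have "z ^ m = z ^ (10 * (m div 10) + m mod 10)" by simp
    also have "\<dots> = z ^ (m mod 10)" unfolding power_add power_mult z10 by simp
    finally show ?thesis by simp
  qed
  have z0: "z \<noteq> 0" using z by auto
  have mult: "char11 z (a * b) = char11 z a * char11 z b" for a b
  proof (cases "11 dvd a \<or> 11 dvd b")
    case False
    have "prime (11 :: int)" by simp
    hence nd: "\<not> 11 dvd a * b" using False prime_dvd_mult_iff by blast
    define i j where "i = nat (a mod 11)" and "j = nat (b mod 11)"
    have ij: "i \<in> set [1..<11]" "j \<in> set [1..<11]"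
      using False pos_mod_bound[of 11 a] pos_mod_bound[of 11 b] pos_mod_sign[of 11 a] pos_mod_sign[of 11 b]
      by (auto simp: i_def j_def dvd_eq_mod_eq_0 nat_less_iff le_nat_iff less_le simp del: upt_rec_numeral)
    have "int i = a mod 11" "int j = b mod 11" by (simp_all add: i_def j_def)
    hence "int (i * j mod 11) = a * b mod 11" by (simp add: zmod_int mod_mult_eq)
    hence "nat (a * b mod 11) = i * j mod 11" by linarith
    moreover have "ind11 (i * j mod 11) = (ind11 i + ind11 j) mod 10"
      using ind11_mult ij by blast
    ultimately have "z ^ ind11 (nat (a * b mod 11)) = z ^ (ind11 i + ind11 j)"
      by (simp only: zmod)
    moreover have "\<not> 11 dvd a" "\<not> 11 dvd b" using False by auto
    ultimately show ?thesis
      using nd by (simp only: char11_def power_add i_def j_def if_False simp_thms)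
  qed (auto simp: char11_def)
  have "prime (11 :: int)" by simp
  hence "coprime a 11 \<longleftrightarrow> \<not> 11 dvd a" for a :: int
    using prime_imp_coprime[of 11 a] coprime_common_divisor[of a 11 11] by (auto simp: coprime_commute)
  hence "dirichlet_character 11 (char11 z)"
    unfolding dirichlet_character_def using mult z0
    by (auto simp: char11_def cong_def cong_dvd_iff dvd_eq_mod_eq_0)
  moreover have "char11 z (-1) = -1" by (simp add: char11_def ind11_def z)
  ultimately show ?thesis by (simp add: odd_dirichlet_characters_def)
qed

text \<open>Turns sums over odd characters into sums over the fifth roots of \<open>-1\<close>; the
  inverse map is \<open>char11\<close>.\<close>

lemma bij_betw_odd_dirichlet_characters_11:
  "bij_betw (\<lambda>chi. chi 2) (odd_dirichlet_characters 11) {z. z ^ 5 = -1}"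
proof (rule bij_betwI)
  show "(\<lambda>chi. chi 2) \<in> odd_dirichlet_characters 11 \<rightarrow> {z. z ^ 5 = -1}"
    using odd_dirichlet_character_11_values(5) by blast
  show "char11 \<in> {z. z ^ 5 = -1} \<rightarrow> odd_dirichlet_characters 11"
    using char11_odd_dirichlet_character by blast
  show "char11 z 2 = z" for z by (simp add: char11_def ind11_def)
  fix chi assume chi: "chi \<in> odd_dirichlet_characters 11"
  have eq: "psi a = psi (a mod 11)" if "psi \<in> odd_dirichlet_characters 11" for psi a
    by (rule odd_dirichlet_characterD(2)[OF that]) (simp add: cong_def)
  let ?psi = "char11 (chi 2)"
  have psi: "?psi \<in> odd_dirichlet_characters 11"
    using char11_odd_dirichlet_character odd_dirichlet_character_11_values(5)[OF chi] by blast
  note v = odd_dirichlet_character_11_values[OF chi] odd_dirichlet_character_11_values[OF psi]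
    odd_dirichlet_characterD(4)[OF chi] odd_dirichlet_characterD(4)[OF psi]
  have 2: "?psi 2 = chi 2" by (simp add: char11_def ind11_def)
  have "?psi a = chi a" for a
  proof -
    have "a mod 11 \<in> {0, 1, 2, 3, 4, 5, 6, 7, 8, 9, 10}"
      using pos_mod_bound[of 11 a] pos_mod_sign[of 11 a] by (simp, presburger)
    thus ?thesis
      unfolding eq[OF chi, of a] eq[OF psi, of a] using v 2 by auto
  qed
  thus "?psi = chi" by blast
qed

lemma power_reduce_5:
  fixes z :: "'a :: comm_monoid_mult"
  assumes "z ^ 5 = c"
  shows "z ^ 6 = c * z" "z ^ 10 = c ^ 2" "z ^ 15 = c ^ 3" "z ^ 16 = c ^ 3 * z"
    "z ^ 20 = c ^ 4" "z ^ 21 = c ^ 4 * z" "z ^ 35 = c ^ 7"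
  using assms power_mult[of z 5 1] power_mult[of z 5 2] power_mult[of z 5 3] power_mult[of z 5 4]
    power_mult[of z 5 7] power_add[of z 5 1] power_add[of z 15 1] power_add[of z 20 1]
  by simp_all

text \<open>For \<open>k\<close> from 1 to 4, \<open>z^k\<close> runs bijectively over the fifth
  roots of \<open>(-1)^k\<close>, and these sum to 0. The witnesses \<open>- (z ^ 3)\<close>,
  \<open>z ^ 7\<close> and \<open>- (z ^ 4)\<close> invert the maps for
  \<open>k = 2, 3, 4\<close>.\<close>

lemma sum_power_roots_minus_one:
  fixes k :: nat
  assumes "k < 5"
  shows "(\<Sum>z | z ^ 5 = (-1::complex). z ^ k) = (if k = 0 then 5 else 0)"
proof -
  have zero: "\<Sum>{z::complex. z ^ 5 = c} = 0" for c by (rule sum_nth_roots) simp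
  consider "k = 0" | "k = 1" | "k = 2" | "k = 3" | "k = 4" using assms by linarith
  thus ?thesis
  proof cases
    case 1
    thus ?thesis using card_nth_roots[of "-1" 5] by simp
  next
    case 2
    thus ?thesis using zero by simp
  next
    case 3
    have "(\<Sum>z | z ^ 5 = (-1::complex). z ^ 2) = \<Sum>{z. z ^ 5 = 1}"
      by (rule sum.reindex_bij_witness[of _ "\<lambda>z. - (z ^ 3)" "\<lambda>z. z ^ 2"]) 
         (simp_all add: power_reduce_5[where c = 1] power_reduce_5[where c = "-1"] power_minus_odd flip: power_mult)
    thus ?thesis using zero 3 by simp
  next
    case 4
    have "(\<Sum>z | z ^ 5 = (-1::complex). z ^ 3) = \<Sum>{z. z ^ 5 = -1}"
      by (rule sum.reindex_bij_witness[of _ "\<lambda>z. z ^ 7" "\<lambda>z. z ^ 3"])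
         (simp_all add: power_reduce_5[where c = 1] power_reduce_5[where c = "-1"] power_minus_odd flip: power_mult)
    thus ?thesis using zero 4 by simp
  next
    case 5
    have "(\<Sum>z | z ^ 5 = (-1::complex). z ^ 4) = \<Sum>{z. z ^ 5 = 1}"
      by (rule sum.reindex_bij_witness[of _ "\<lambda>z. - (z ^ 4)" "\<lambda>z. z ^ 4"])
         (simp_all add: power_reduce_5[where c = 1] power_reduce_5[where c = "-1"] power_minus_odd flip: power_mult)
    thus ?thesis using zero 5 by simp
  qed
qed

lemma sum_odd_dirichlet_characters_11:
  shows "(\<Sum>chi\<in>odd_dirichlet_characters 11. chi 1) = 5"
    "(\<Sum>chi\<in>odd_dirichlet_characters 11. chi 2) = 0"
    "(\<Sum>chi\<in>odd_dirichlet_characters 11. chi 3) = 0"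
    "(\<Sum>chi\<in>odd_dirichlet_characters 11. chi 4) = 0"
    "(\<Sum>chi\<in>odd_dirichlet_characters 11. chi 5) = 0"
proof -
  have pow: "(\<Sum>chi\<in>odd_dirichlet_characters 11. chi 2 ^ k) = (if k = 0 then 5 else 0)"
    if "k < 5" for k
    using sum.reindex_bij_betw[OF bij_betw_odd_dirichlet_characters_11, of "\<lambda>z. z ^ k"]
      sum_power_roots_minus_one[OF that] by simp
  have val: "(\<Sum>chi\<in>odd_dirichlet_characters 11. chi a) =
      (\<Sum>chi\<in>odd_dirichlet_characters 11. c * chi 2 ^ k)"
    if "\<And>chi. chi \<in> odd_dirichlet_characters 11 \<Longrightarrow> chi a = c * chi 2 ^ k" for a c k
    using that by (rule sum.cong[OF refl])
  note v = odd_dirichlet_character_11_values odd_dirichlet_characterD(4)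
  show "(\<Sum>chi\<in>odd_dirichlet_characters 11. chi 1) = 5"
    using val[of 1 1 0] pow[of 0] v by simp
  show "(\<Sum>chi\<in>odd_dirichlet_characters 11. chi 2) = 0" using pow[of 1] by simp
  show "(\<Sum>chi\<in>odd_dirichlet_characters 11. chi 3) = 0"
    using val[of 3 "-1" 3, unfolded mult_minus_left mult_1_left, OF v(2)] pow[of 3]
    by (simp add: sum_negf)
  show "(\<Sum>chi\<in>odd_dirichlet_characters 11. chi 4) = 0"
    using val[of 4 1 2] pow[of 2] v by simp
  show "(\<Sum>chi\<in>odd_dirichlet_characters 11. chi 5) = 0"
    using val[of 5 1 4] pow[of 4] v by simp
qed

section \<open>Eisenstein series of level 11\<close>

lemma norm_q_param:
  assumes "Im \<tau> > 0"
  shows "0 < norm (q_param \<tau>)" "norm (q_param \<tau>) < 1"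
  using assms by (simp_all add: q_param_def mult_pos_pos)

lemma sum_1_5: "(\<Sum>m=Suc 0..5. g m) = g 1 + g 2 + g 3 + g 4 + g (5 :: nat)"
  by (simp add: numeral_eq_Suc ac_simps)

text \<open>The mean of the partial sums equals minus the sum of \<open>chi(j) j / 11\<close>;
  oddness pairs \<open>j\<close> with \<open>11 - j\<close>. Nonvanishing holds because, as a
  polynomial in \<open>chi 2\<close>, the value is a unit modulo \<open>z^5 + 1\<close>.\<close>

lemma dirichlet_L_0_odd_11:
  assumes "chi \<in> odd_dirichlet_characters 11"
  shows "dirichlet_L chi 0 = (\<Sum>m=1..5. chi (int m) * (1 - 2 * of_nat m / 11))"
    "dirichlet_L chi 0 \<noteq> 0"
proof -
  note D = odd_dirichlet_characterD[OF assms]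
  note v = odd_dirichlet_character_11_values[OF assms] D(4)
  have 11: "chi 11 = 0" using D(3)[of 11] by simp
  have "dirichlet_L chi 0 = (\<Sum>n<11. \<Sum>k\<le>n. chi (int (Suc k))) / of_nat 11"
  proof (rule dirichlet_L_0_periodic)
    show "chi (n + int 11) = chi n" for n by (rule D(2)) (simp add: cong_def)
    show "(\<Sum>k<11. chi (int (Suc k))) = 0"
      using v 11 by (simp add: lessThan_nat_numeral)
  qed simp
  also have "\<dots> = (\<Sum>m=1..5. chi (int m) * (1 - 2 * of_nat m / 11))"
    using v(1,6-) 11
    by (simp add: lessThan_nat_numeral atMost_nat_numeral atMost_0 sum_1_5 field_simps)
  finally show L: "dirichlet_L chi 0 = (\<Sum>m=1..5. chi (int m) * (1 - 2 * of_nat m / 11))" .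
  define z where "z = chi 2"
  have z5: "z ^ 5 = -1" using v(5) by (simp add: z_def)
  text \<open>The factor \<open>1 - z + z\<^sup>2 - z\<^sup>4\<close> below inverts the polynomial modulo \<open>z\<^sup>5 + 1\<close>, up to the factor \<open>22\<close>.\<close>
  have "11 * dirichlet_L chi 0 = 9 + 7 * z + 3 * z ^ 2 - 5 * z ^ 3 + z ^ 4"
    unfolding L using v by (simp add: sum_1_5 z_def field_simps)
  hence "11 * dirichlet_L chi 0 * (1 - z + z ^ 2 - z ^ 4) =
      (9 + 7 * z + 3 * z ^ 2 - 5 * z ^ 3 + z ^ 4) * (1 - z + z ^ 2 - z ^ 4)" by simp
  also have "\<dots> = 22 + (z ^ 5 + 1) * (5 * z ^ 2 - z ^ 3 - 2 * z - 13)"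
    by (simp add: eval_nat_numeral algebra_simps)
  also have "\<dots> = 22" using z5 by simp
  finally show "dirichlet_L chi 0 \<noteq> 0" by auto
qed

text \<open>Sorting by residues modulo 11 and pairing \<open>r\<close> with \<open>11 - r\<close> by
  oddness gives differences of one-sided series, which \<open>bilateral_lambert_powers\<close>
  identifies.\<close>

lemma lambert_sum_odd_11:
  fixes q :: complex
  assumes chi: "chi \<in> odd_dirichlet_characters 11" and q: "0 < norm q" "norm q < 1"
  shows "(\<Sum>n. chi (int (Suc n)) * (q ^ Suc n / (1 - q ^ Suc n))) =
    (\<Sum>m=1..5. chi (int m) * bilateral_lambert (q ^ 11) (q ^ m))"
proof -
  note D = odd_dirichlet_characterD[OF chi]
  note v = odd_dirichlet_character_11_values[OF chi] D(4)
  let ?f = "\<lambda>n. q ^ n / (1 - q ^ n)"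
  define L where "L = (\<lambda>r. \<Sum>\<^sub>\<infinity>k. ?f (r + 11 * k))"
  have per: "chi (int (r + 11 * k)) = chi (int r)" for r k
    by (rule D(2)) (simp add: cong_def)
  have bound: "norm (chi (int n)) \<le> (\<Sum>r<11. norm (chi (int r)))" for n
  proof -
    have "norm (chi (int n)) = norm (chi (int (n mod 11)))"
      using per[of "n mod 11" "n div 11"] by simp
    also have "\<dots> \<le> (\<Sum>r<11. norm (chi (int r)))" by (rule member_le_sum) auto
    finally show ?thesis .
  qed
  note summ = summable_on_lambert[of q "\<lambda>n. chi (int n)", OF q(2) bound]
  have "(\<lambda>k. ?f (r + 11 * k)) summable_on UNIV" for r
  proof -
    have "?f summable_on range (\<lambda>k. r + 11 * k)"
      using summable_on_lambert[of q "\<lambda>_. 1" 1, OF q(2)] by (auto intro: summable_on_subset)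
    thus ?thesis by (subst (asm) summable_on_reindex) (auto simp: inj_on_def o_def)
  qed
  from infsum_residue_classes[of 11 "\<lambda>n. chi (int n)" ?f, OF _ per summ this]
  have S: "(\<Sum>\<^sub>\<infinity>n. chi (int n) * ?f n) = (\<Sum>r<11. chi (int r) * L r)" by (simp add: L_def)
  have "(\<lambda>n. chi (int n) * ?f n) sums (\<Sum>r<11. chi (int r) * L r)"
    using has_sum_imp_sums[OF has_sum_infsum[OF summ]] unfolding S .
  \<comment> \<open>The term at index 0 vanishes, again through \<open>1 / 0 = 0\<close>, so the
    shift leaves the sum unchanged.\<close>
  hence "(\<lambda>n. chi (int (Suc n)) * ?f (Suc n)) sums (\<Sum>r<11. chi (int r) * L r)"
    by (subst sums_Suc_iff) simp
  hence "(\<Sum>n. chi (int (Suc n)) * ?f (Suc n)) = (\<Sum>r<11. chi (int r) * L r)"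
    by (rule sums_unique[symmetric])
  also have "\<dots> = (\<Sum>m=1..5. chi (int m) * (L m - L (11 - m)))"
    using v(1,6-) by (simp add: lessThan_nat_numeral sum_1_5 algebra_simps)
  also have "\<dots> = (\<Sum>m=1..5. chi (int m) * bilateral_lambert (q ^ 11) (q ^ m))"
    using bilateral_lambert_powers(3)[OF q, of _ 11]
    by (intro sum.cong refl) (simp add: L_def)
  finally show ?thesis .
qed

text \<open>The constant makes \<open>toric11 \<tau> (11 - m) = - toric11 \<tau> m\<close>.\<close>

definition toric11 :: "complex \<Rightarrow> nat \<Rightarrow> complex" where
  "toric11 \<tau> m = 1 / 2 - of_nat m / 11 + bilateral_lambert (q_param \<tau> ^ 11) (q_param \<tau> ^ m)"

text \<open>The first factor on the left is \<open>L(0, chi) / 2\<close>. Multiplying by it clears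
  the denominator in \<open>eisenstein_E1\<close> and spreads the constant term over the five values
  of \<open>toric11\<close>.\<close>

lemma eisenstein_E1_toric11:
  assumes chi: "chi \<in> odd_dirichlet_characters 11" and \<tau>: "Im \<tau> > 0"
  shows "(\<Sum>m=1..5. chi (int m) * (1 / 2 - of_nat m / 11)) * eisenstein_E1 chi \<tau> =
    (\<Sum>m=1..5. chi (int m) * toric11 \<tau> m)"
proof -
  define q where "q = q_param \<tau>"
  let ?L = "dirichlet_L chi 0"
  have half: "(\<Sum>m=1..5. chi (int m) * (1 / 2 - of_nat m / 11)) = ?L / 2"
    unfolding dirichlet_L_0_odd_11(1)[OF chi] sum_divide_distrib
    by (intro sum.cong refl) (simp add: field_simps)
  have "?L / 2 * eisenstein_E1 chi \<tau> =
      ?L / 2 + (\<Sum>n. chi (int (Suc n)) * (q ^ Suc n / (1 - q ^ Suc n)))"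
    unfolding eisenstein_E1_def q_def[symmetric] using dirichlet_L_0_odd_11(2)[OF chi]
    by (simp only: distrib_left) simp
  also have "\<dots> = (\<Sum>m=1..5. chi (int m) * (1 / 2 - of_nat m / 11))
      + (\<Sum>m=1..5. chi (int m) * bilateral_lambert (q ^ 11) (q ^ m))"
    using lambert_sum_odd_11[OF chi, of q] norm_q_param[OF \<tau>] half by (simp add: q_def)
  also have "\<dots> = (\<Sum>m=1..5. chi (int m) * toric11 \<tau> m)"
    by (simp add: toric11_def q_def distrib_left sum.distrib)
  finally show ?thesis unfolding half .
qed

section \<open>Inversion of the character transform\<close>

lemma cal_E11_reduce: "cal_E11 (a mod 11) \<tau> = cal_E11 a \<tau>" "cal_E11 (- a) \<tau> = - cal_E11 a \<tau>"
proof -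
  have "chi (a mod 11) = chi a" if "chi \<in> odd_dirichlet_characters 11" for chi
    by (rule odd_dirichlet_characterD(2)[OF that]) (simp add: cong_def)
  thus "cal_E11 (a mod 11) \<tau> = cal_E11 a \<tau>"
    unfolding cal_E11_def by (intro arg_cong2[of _ _ _ _ "(*)"] sum.cong refl)
  show "cal_E11 (- a) \<tau> = - cal_E11 a \<tau>"
    by (simp add: cal_E11_def odd_dirichlet_characterD(5) sum_negf cong: sum.cong)
qed

text \<open>Periodicity and oddness reduce every argument to one of 0, ..., 5, where the sums are
  known.\<close>

lemma orthogonality_11:
  "(\<Sum>chi\<in>odd_dirichlet_characters 11. chi a) =
     (if a mod 11 = 1 then 5 else if a mod 11 = 10 then -5 else 0)"
proof -
  let ?S = "\<lambda>a. \<Sum>chi\<in>odd_dirichlet_characters 11. chi a"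
  have eq: "?S a = ?S (a mod 11)"
    by (intro sum.cong refl odd_dirichlet_characterD(2)) (auto simp: cong_def)
  have neg: "?S (- b) = - ?S b" for b
    by (simp add: odd_dirichlet_characterD(5) sum_negf cong: sum.cong)
  have shift: "?S (11 - b) = - ?S b" for b
    unfolding neg[symmetric] by (intro sum.cong refl odd_dirichlet_characterD(2)) (auto simp: cong_iff_dvd_diff)
  have zero: "?S 0 = 0" using neg[of 0] by simp
  note S = sum_odd_dirichlet_characters_11
  have "?S 6 = 0" "?S 7 = 0" "?S 8 = 0" "?S 9 = 0" "?S 10 = -5"
    using shift[of 1] shift[of 2] shift[of 3] shift[of 4] shift[of 5] S by simp_all
  moreover have "a mod 11 \<in> {0, 1, 2, 3, 4, 5, 6, 7, 8, 9, 10}"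
    using pos_mod_bound[of 11 a] pos_mod_sign[of 11 a] by (simp, presburger)
  ultimately show ?thesis unfolding eq using S zero by auto
qed

text \<open>Multiply \<open>eisenstein_E1_toric11\<close> by \<open>chi b / 5\<close> and sum over
  the odd characters; orthogonality keeps only those \<open>m\<close> with \<open>m * b\<close>
  congruent to 1 or \<open>-1\<close>.\<close>

lemma cal_E11_toric11:
  assumes \<tau>: "Im \<tau> > 0"
  shows "(\<Sum>m=1..5. (1 / 2 - of_nat m / 11) * cal_E11 (int m * b) \<tau>) =
    (\<Sum>m=1..5. toric11 \<tau> m * (if int m * b mod 11 = 1 then 1 else if int m * b mod 11 = 10 then -1 else 0))"
proof -
  let ?X = "odd_dirichlet_characters 11"
  have mult: "chi (c * d) = chi c * chi d" if "chi \<in> ?X" for chi c d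
    by (rule odd_dirichlet_characterD(1)[OF that])
  have "(\<Sum>m=1..5. (1 / 2 - of_nat m / 11) * cal_E11 (int m * b) \<tau>) =
      (\<Sum>m=1..5. \<Sum>chi\<in>?X. 1 / 5 * chi b * (chi (int m) * (1 / 2 - of_nat m / 11)) * eisenstein_E1 chi \<tau>)"
    unfolding cal_E11_def sum_distrib_left by (intro sum.cong refl) (simp add: mult mult_ac)
  also have "\<dots> = (\<Sum>chi\<in>?X. 1 / 5 * chi b *
      ((\<Sum>m=1..5. chi (int m) * (1 / 2 - of_nat m / 11)) * eisenstein_E1 chi \<tau>))"
    by (subst sum.swap) (simp only: sum_distrib_left sum_distrib_right mult.assoc)
  also have "\<dots> = (\<Sum>chi\<in>?X. 1 / 5 * chi b * (\<Sum>m=1..5. chi (int m) * toric11 \<tau> m))"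
    by (intro sum.cong refl) (simp only: eisenstein_E1_toric11[OF _ \<tau>])
  also have "\<dots> = (\<Sum>m=1..5. toric11 \<tau> m * (1 / 5 * (\<Sum>chi\<in>?X. chi (int m * b))))"
    unfolding sum_distrib_left
    by (subst sum.swap, intro sum.cong refl) (simp add: mult mult_ac)
  finally show ?thesis 
    unfolding orthogonality_11 by (rule trans) (intro sum.cong refl, simp)
qed

text \<open>Taking \<open>b\<close> to be the inverse of \<open>m\<close> modulo 11, namely 1, 6, 4,
  3, 9 for \<open>m = 1, ..., 5\<close>, isolates \<open>toric11\<close> at \<open>m\<close>. The
  factor 22 clears \<open>1/2 - m/11 = (11 - 2 m) / 22\<close>.\<close>

lemma toric11_cal_E11:
  fixes \<tau> :: complex
  assumes \<tau>: "Im \<tau> > 0"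
  defines "e \<equiv> \<lambda>a. cal_E11 a \<tau>"
  shows "22 * toric11 \<tau> 1 = 9 * e 1 - 7 * e 9 + 5 * e 3 - 3 * e 7 + e 5"
    "22 * toric11 \<tau> 2 = - 9 * e 5 + 7 * e 1 + 5 * e 7 - 3 * e 9 - e 3"
    "22 * toric11 \<tau> 3 = - 9 * e 7 - 7 * e 3 + 5 * e 1 + 3 * e 5 + e 9"
    "22 * toric11 \<tau> 4 = 9 * e 3 - 7 * e 5 + 5 * e 9 + 3 * e 1 - e 7"
    "22 * toric11 \<tau> 5 = 9 * e 9 + 7 * e 7 + 5 * e 5 + 3 * e 3 + e 1"
proof -
  have r: "e (a mod 11) = e a" and n: "e (- a) = - e a" for a
    by (simp_all add: e_def cal_E11_reduce)
  have red: "e 12 = e 1" "e 18 = e 7" "e 24 = e 2" "e 30 = e 8" "e 16 = e 5" "e 20 = e 9"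
      "e 15 = e 4" "e 27 = e 5" "e 36 = e 3" "e 45 = e 1"
    using r[of 12] r[of 18] r[of 24] r[of 30] r[of 16] r[of 20] r[of 15] r[of 27] r[of 36] r[of 45]
    by simp_all
  \<comment> \<open>Oddness removes the even indices, leaving 1, 3, 5, 7, 9.\<close>
  have neg: "e 2 = - e 9" "e 4 = - e 7" "e 6 = - e 5" "e 8 = - e 3"
    using r[of "-9"] r[of "-7"] r[of "-5"] r[of "-3"] n[of 9] n[of 7] n[of 5] n[of 3] by simp_all
  have X: "(\<Sum>m=1..5. (11 - 2 * of_nat m) * e (int m * b)) = 22 *
      (\<Sum>m=1..5. toric11 \<tau> m * (if int m * b mod 11 = 1 then 1 else if int m * b mod 11 = 10 then -1 else 0))"
    for b
    unfolding cal_E11_toric11[OF \<tau>, symmetric] sum_distrib_left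
    by (intro sum.cong refl) (simp add: e_def field_simps)
  note s = sum_1_5 red neg
  show "22 * toric11 \<tau> 1 = 9 * e 1 - 7 * e 9 + 5 * e 3 - 3 * e 7 + e 5"
    using X[of 1] by (simp add: s algebra_simps)
  show "22 * toric11 \<tau> 2 = - 9 * e 5 + 7 * e 1 + 5 * e 7 - 3 * e 9 - e 3"
    using X[of 6] by (simp add: s algebra_simps)
  show "22 * toric11 \<tau> 3 = - 9 * e 7 - 7 * e 3 + 5 * e 1 + 3 * e 5 + e 9"
    using X[of 4] by (simp add: s algebra_simps)
  show "22 * toric11 \<tau> 4 = 9 * e 3 - 7 * e 5 + 5 * e 9 + 3 * e 1 - e 7"
    using X[of 3] by (simp add: s algebra_simps)
  show "22 * toric11 \<tau> 5 = 9 * e 9 + 7 * e 7 + 5 * e 5 + 3 * e 3 + e 1"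
    using X[of 9] by (simp add: s algebra_simps)
qed

section \<open>Elimination of the second series\<close>

theorem theorem5p2:
  fixes \<tau> :: complex
  assumes "Im \<tau> > 0"
  shows "cal_E11 3 \<tau> * cal_E11 7 \<tau> + cal_E11 1 \<tau> * cal_E11 7 \<tau>
           - cal_E11 3 \<tau> * cal_E11 5 \<tau> - cal_E11 5 \<tau> * cal_E11 7 \<tau> = 0 \<and>
         cal_E11 1 \<tau> * cal_E11 3 \<tau> - cal_E11 1 \<tau> * cal_E11 5 \<tau>
           + cal_E11 5 \<tau> * cal_E11 7 \<tau> = 0"
proof -
  define q where "q = q_param \<tau>"
  have q: "0 < norm q" "norm q < 1" using norm_q_param[OF assms] by (simp_all add: q_def)
  \<comment> \<open>Scaling the first series by 22 and the second by \<open>484 = 22^2\<close> makes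
    all coefficients below integers.\<close>
  define K where "K = (\<lambda>r. 22 * bilateral_lambert (q ^ 11) (q ^ r))"
  define U where "U = (\<lambda>r. 484 * bilateral_lambert2 (q ^ 11) (q ^ r))"
  define X where "X = (\<lambda>r s. K r * K s - K (r + s) * (K r + K s) - (22 * K (r + s) + U (r + s) + U r + U s))"
  \<comment> \<open>\<open>X r s\<close> is 484 times the defect of the addition theorem at
    \<open>q^r\<close>, \<open>q^s\<close>; \<open>r + s < 11\<close> keeps the product inside the
    annulus.\<close>
  have X0: "X r s = 0" if "0 < r" "0 < s" "r + s < 11" for r s
  proof -
    note pow = bilateral_lambert_powers(1,2)[OF q, of _ 11]
    let ?J = "bilateral_lambert (q ^ 11)" and ?T = "bilateral_lambert2 (q ^ 11)"
    have "?J (q ^ r) * ?J (q ^ s) - ?J (q ^ r * q ^ s) * (?J (q ^ r) + ?J (q ^ s)) =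
        ?J (q ^ r * q ^ s) + ?T (q ^ r * q ^ s) + ?T (q ^ r) + ?T (q ^ s)"
      by (rule bilateral_lambert_addition)
         (use pow(1)[of "r + s"] pow(2)[of r] pow(2)[of s] that q in \<open>auto simp: power_add\<close>)
    from arg_cong[OF this, of "\<lambda>z. 484 * z"] show ?thesis
      by (simp add: X_def K_def U_def power_add algebra_simps)
  qed
  have refl: "K (11 - r) = - K r" "U (11 - r) = U r + 22 * K r" if "0 < r" "r < 11" for r
  proof -
    have "q ^ (11 - r) = q ^ 11 / q ^ r" using q that by (auto simp: power_diff)
    moreover have "0 < norm (q ^ 11)" using q by simp
    ultimately show "K (11 - r) = - K r" "U (11 - r) = U r + 22 * K r"
      using bilateral_lambert_reflect[OF _ bilateral_lambert_powers(1,2)[OF q that]]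
        bilateral_lambert2_reflect[OF _ bilateral_lambert_powers(1,2)[OF q that]]
      by (simp_all add: K_def U_def distrib_left)
  qed
  \<comment> \<open>Indices 6 and 7 occur in \<open>X 2 4\<close>, \<open>X 3 3\<close> and
    \<open>X 3 4\<close>; reflection brings them back to 5 and 4.\<close>
  have K67: "K 6 = - K 5" "K 7 = - K 4" "U 6 = U 5 + 22 * K 5" "U 7 = U 4 + 22 * K 4"
    using refl[of 5] refl[of 4] by simp_all
  define a b c d f where abcdf: "a = cal_E11 1 \<tau>" "b = cal_E11 3 \<tau>" "c = cal_E11 5 \<tau>"
    "d = cal_E11 7 \<tau>" "f = cal_E11 9 \<tau>"
  \<comment> \<open>Both \<open>f\<close> and the constants \<open>2 * r - 11\<close> enter these
    expressions for \<open>r = 1, ..., 5\<close> but cancel in the two combinations below.\<close>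
  have "K r = 22 * toric11 \<tau> r + (2 * of_nat r - 11)" for r
    by (simp add: toric11_def K_def q_def field_simps)
  note this[of 1] this[of 2] this[of 3] this[of 4] this[of 5]
  note K = this[unfolded toric11_cal_E11[OF assms], folded abcdf]
  text \<open>These are the integer combinations of the addition formulas from which all \<open>U r\<close> drop out.\<close>
  have "484 * (b * d + a * d - b * c - c * d) = - X 1 1 + X 1 2 + X 1 3 - X 2 3 + X 2 4 - X 3 4"
    unfolding X_def by (simp add: K67 del: One_nat_def, simp add: K algebra_simps del: One_nat_def)
  also have "\<dots> = 0" by (simp add: X0)
  finally have "b * d + a * d - b * c - c * d = 0" by (simp only: mult_eq_0_iff) simp
  moreover have "a * b - a * c + c * d = 0"
  proof -
    have "484 * (a * b - a * c + c * d) = X 1 2 - X 1 3 - X 2 2 + X 2 3 - X 3 3 + X 3 4"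
      unfolding X_def by (simp add: K67 del: One_nat_def, simp add: K algebra_simps del: One_nat_def)
    also have "\<dots> = 0" by (simp add: X0)
    finally show ?thesis by (simp only: mult_eq_0_iff) simp
  qed
  ultimately show ?thesis unfolding abcdf by blast
qed

end
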